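(* Let $X$ be a dense connectible subset of $C\times(0,1)$. Then $W[X]$ is connected. If, additionally, $X$ is hereditarily disconnected, then $W[X]$ is widely-connected.
   Context: $C$ is the middle-thirds Cantor set in $[0,1]$, and $\omega=\{0,1,2,\dots\}$. A set $X\subseteq C\times(0,1)$ is *connectible* if $\langle c,0\rangle\in A$ whenever $A$ is a clopen subset of $X\cup(C\times\{0\})$ (subspace topology from $C\times[0,1]$), $c\in C$, and $A\cap(\{c\}\times(0,1))\neq\varnothing$. A space is *hereditarily disconnected* if no connected subset of it has more than one point. A connected space $X$ (with more than one point) is *widely-connected* if every connected subset of $X$ with more than one point is dense in $X$. $K\subseteq[0,1]^2$ is the (rectilinear) Knaster bucket-handle continuum, $\Delta=\{\langle x,x\rangle\in K:x\in[0,1]\}$ is its diagonal Cantor set, and $K\setminus\Delta=\bigcup_{i<\omega}K_i$ is the disjoint union of open copies $K_i$ of $C\times(0,1)$, with homeomorphisms $\varphi_i:C\times(0,1)\to K_i$. Explicitly, $\Delta=\{\langle x,x\rangle:x\in C\}$, and the maps are as follows. - For $i=0$ and $c\in C$, put $x=c/3$ and $y=1-x$. Then $\varphi_0(c,t)=\langle x,\,x+2t(y-x)\rangle$ for $0<t\le 1/2$, and $\varphi_0(c,t)=\langle x+(2t-1)(y-x),\,y\rangle$ for $1/2\le t<1$. - For $i\ge1$ and $c\in C$, put $x=2/3^i+c/3^{i+1}$ and $y=5/3^i-x$. Then $\varphi_i(c,t)=\langle x+2t(y-x),\,x\rangle$ for $0<t\le1/2$, and $\varphi_i(c,t)=\langle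 y,\,x+(2t-1)(y-x)\rangle$ for $1/2\le t<1$. Put $K_i=\varphi_i[C\times(0,1)]$ and $K=\Delta\cup\bigcup_{i<\omega}K_i$. For $X\subseteq C\times(0,1)$ define $W[X]=\Delta\cup\bigcup_{i<\omega}\varphi_i[X]$, with the subspace topology from $K\subseteq\mathbb R^2$. *)

theory Defs
  imports "HOL-Analysis.Analysis"
begin

primrec cantor_stage :: "nat \<Rightarrow> real set" where
  "cantor_stage 0 = {0..1}"
| "cantor_stage (Suc n) =
     (\<lambda>x. x / 3) ` cantor_stage n \<union> (\<lambda>x. 2 / 3 + x / 3) ` cantor_stage n"

definition cantor :: "real set" where
  "cantor = (\<Inter>n. cantor_stage n)"

text \<open>
  Spaces are given as sets in an ambient topological space, always with the subspace topology.
\<close>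

definition clopen_in :: "'a::topological_space set \<Rightarrow> 'a set \<Rightarrow> bool" where
  "clopen_in S A \<longleftrightarrow> openin (top_of_set S) A \<and> closedin (top_of_set S) A"

definition connectible :: "(real \<times> real) set \<Rightarrow> bool" where
  "connectible X \<longleftrightarrow>
     X \<subseteq> cantor \<times> {0<..<1} \<and>
     (\<forall>A. \<forall>c\<in>cantor. clopen_in (X \<union> cantor \<times> {0}) A \<and> A \<inter> ({c} \<times> {0<..<1}) \<noteq> {}
        \<longrightarrow> (c, 0) \<in> A)"

definition hereditarily_disconnected :: "'a::topological_space set \<Rightarrow> bool" where
  "hereditarily_disconnected X \<longleftrightarrow>
     \<not> (\<exists>S\<subseteq>X. connected S \<and> (\<exists>x\<in>S. \<exists>y\<in>S. x \<noteq> y))"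

definition widely_connected :: "'a::topological_space set \<Rightarrow> bool" where
  "widely_connected X \<longleftrightarrow>
     connected X \<and> (\<exists>x\<in>X. \<exists>y\<in>X. x \<noteq> y) \<and>
     (\<forall>S\<subseteq>X. connected S \<and> (\<exists>x\<in>S. \<exists>y\<in>S. x \<noteq> y) \<longrightarrow> X \<subseteq> closure S)"

text \<open>
  The diagonal Cantor set of the rectilinear Knaster bucket-handle continuum, and the
  parametrisations of the open pieces into which it cuts the continuum. Only the values of
  \<open>\<phi> i\<close> on \<open>cantor \<times> {0<..<1}\<close> are meaningful.
\<close>

definition \<Delta> :: "(real \<times> real) set" where
  "\<Delta> = (\<lambda>x. (x, x)) ` cantor"

definition \<phi> :: "nat \<Rightarrow> real \<times> real \<Rightarrow> real \<times> real" where
  "\<phi> i = (\<lambda>(c, t).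
     if i = 0 then
       let x = c / 3; y = 1 - x in
         if t \<le> 1 / 2 then (x, x + 2 * t * (y - x)) else (x + (2 * t - 1) * (y - x), y)
     else
       let x = 2 / 3 ^ i + c / 3 ^ (i + 1); y = 5 / 3 ^ i - x in
         if t \<le> 1 / 2 then (x + 2 * t * (y - x), x) else (y, x + (2 * t - 1) * (y - x)))"

definition W :: "(real \<times> real) set \<Rightarrow> (real \<times> real) set" where
  "W X = \<Delta> \<union> (\<Union>i. \<phi> i ` X)"

text \<open>
  The continuum itself is \<open>W (cantor \<times> {0<..<1})\<close>. The topology that \<open>W X\<close> inherits from it
  agrees with the one inherited from the plane.
\<close>

end

theory Submission
  imports Defs
begin

text \<open>
  For fixed \<open>c\<close> the map \<open>\<phi> j (c, _)\<close> extends to an arc that joins two points of the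
  diagonal, and the arcs pair up the points of the Cantor set: the arcs above the diagonal
  (\<open>j = 0\<close>) join \<open>x\<close> to \<open>1 - x\<close>, the arcs below it (\<open>j > 0\<close>) join \<open>x\<close> to
  \<open>5 / 3 ^ j - x\<close> on the part of the Cantor set in \<open>[2 / 3 ^ j, 3 / 3 ^ j]\<close>. This gives two
  involutions \<open>flip_above\<close> and \<open>flip_below\<close> (the latter fixing \<open>0\<close>), and travelling along
  the continuum means applying them alternately. Everything rests on one fact about them. Read the
  ternary digits \<open>0\<close> and \<open>2\<close> as bits. Then \<open>flip_above\<close> complements every bit,
  \<open>flip_below\<close> complements every bit after the first 1, and \<open>flip_below \<circ> flip_above\<close> is
  the binary adding machine. On the first \<open>n\<close> bits the adding machine is a single cycle of
  length \<open>2 ^ n\<close>, so every journey, in either direction, visits every cylinder within a bounded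
  number of steps (\<open>below_above_recurrence\<close>, \<open>above_below_recurrence\<close>).

  Connectedness. Let \<open>A\<close> be clopen in \<open>W X\<close>. Pulled back along \<open>\<phi> j\<close> it is clopen in
  \<open>X \<union> cantor \<times> {0}\<close>, so by connectibility, applied to \<open>A\<close> and to its complement, each
  fibre of \<open>X\<close> is carried by \<open>\<phi> j\<close> to the side on which the arc starts. Since \<open>X\<close> is
  dense, the end of the arc is a limit of points on nearby arcs and lies on that side too
  (\<open>connectible_arc_end\<close>). The diagonal part of \<open>A\<close> is therefore a clopen subset of the
  Cantor set that is invariant under both involutions; recurrence makes it empty or everything
  (\<open>invariant_clopen_trivial\<close>), and then so is \<open>A\<close>.

  Wide connectedness. Let \<open>S \<subseteq> W X\<close> be connected but not dense. Then \<open>S\<close> misses a whole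
  strip of parallel arcs at some height \<open>r\<close>; cut the continuum there. By recurrence a
  journey from any point runs into the cut after finitely many steps in both directions, so it
  visits only a finite set \<open>F\<close> of diagonal points (\<open>finite_block_of_endpoints\<close>). Thickening
  \<open>F\<close> to the cylinders of level \<open>m\<close> around it, and attaching the arcs up to the cut, splits
  the cut continuum into two closed sets. Hence \<open>S\<close> lies within these thickenings for all
  large \<open>m\<close>, that is, it meets only finitely many of the arcs of each family
  (\<open>nondense_meets_finitely_many_arcs\<close>). Now each arc that \<open>S\<close> meets is isolated from the
  others of its family. If \<open>X\<close> is hereditarily disconnected, then its fibres have holes
  arbitrarily close to any height, and between two holes a piece of an isolated arc is clopen in
  \<open>S\<close> (\<open>confined_to_subarc\<close>). So \<open>S\<close> shrinks to a single point.
\<close>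

section \<open>The Cantor set and its addresses\<close>

lemma cantor_stage_unit: "cantor_stage n \<subseteq> {0..1}"
  by (induction n) (force simp: field_simps)+

lemma cantor_bounds: "x \<in> cantor \<Longrightarrow> 0 \<le> x \<and> x \<le> 1"
  using cantor_stage_unit[of 0] unfolding cantor_def by (auto dest: spec[of _ 0])

lemma compact_cantor: "compact cantor"
proof -
  have stage: "compact (cantor_stage n)" for n
  proof (induction n)
    case (Suc n)
    have "compact ((\<lambda>x. x / 3) ` cantor_stage n)" "compact ((\<lambda>x. 2 / 3 + x / 3) ` cantor_stage n)"
      by (intro compact_continuous_image continuous_intros Suc; simp)+
    then show ?case by (simp add: compact_Un)
  qed simp
  have "closed cantor"
    unfolding cantor_def by (intro closed_INT ballI compact_imp_closed stage)
  moreover have "bounded cantor"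
    by (rule bounded_subset[of "{0..1}"]) (use cantor_bounds in auto)
  ultimately show ?thesis by (simp add: compact_eq_bounded_closed)
qed

lemma cantor_thirds:
  assumes "w \<in> cantor"
  shows "w / 3 \<in> cantor" "2 / 3 + w / 3 \<in> cantor"
proof -
  have "w / 3 \<in> cantor_stage n \<and> 2 / 3 + w / 3 \<in> cantor_stage n" for n
  proof (cases n)
    case 0
    then show ?thesis using cantor_bounds[OF assms] by simp
  next
    case (Suc m)
    moreover have "w \<in> cantor_stage m" using assms by (simp add: cantor_def)
    ultimately show ?thesis by auto
  qed
  then show "w / 3 \<in> cantor" "2 / 3 + w / 3 \<in> cantor" by (auto simp: cantor_def)
qed

lemma cantor_cases [consumes 1, case_names left right]:
  assumes "x \<in> cantor"
  obtains w where "w \<in> cantor" "x = w / 3" | w where "w \<in> cantor" "x = 2 / 3 + w / 3"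
proof (cases "x \<le> 1/3")
  case True
  have "3 * x \<in> cantor_stage n" for n
  proof -
    have "x \<in> cantor_stage (Suc n)" using assms unfolding cantor_def by blast
    then show ?thesis using cantor_stage_unit[of n] True by force
  qed
  then show ?thesis using that(1)[of "3 * x"] by (simp add: cantor_def)
next
  case False
  have "3 * x - 2 \<in> cantor_stage n" for n
  proof -
    have "x \<in> cantor_stage (Suc n)" using assms unfolding cantor_def by blast
    then show ?thesis using cantor_stage_unit[of n] False by force
  qed
  then show ?thesis using that(2)[of "3 * x - 2"] by (simp add: cantor_def diff_divide_distrib)
qed

lemma zero_in_cantor: "0 \<in> cantor"
proof -
  have "0 \<in> cantor_stage n" for n by (induction n) force+
  then show ?thesis by (simp add: cantor_def)
qed

lemma cantor_reflect:
  assumes "x \<in> cantor"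
  shows "1 - x \<in> cantor"
proof -
  have "y \<in> cantor_stage n \<Longrightarrow> 1 - y \<in> cantor_stage n" for n y
  proof (induction n arbitrary: y)
    case (Suc n)
    from Suc.prems consider z where "z \<in> cantor_stage n" "y = z / 3"
      | z where "z \<in> cantor_stage n" "y = 2 / 3 + z / 3" by auto
    then show ?case
    proof cases
      case 1
      then have "1 - y = 2 / 3 + (1 - z) / 3" by (simp add: field_simps)
      with Suc.IH[OF 1(1)] show ?thesis unfolding cantor_stage.simps by blast
    next
      case 2
      then have "1 - y = (1 - z) / 3" by (simp add: field_simps)
      with Suc.IH[OF 2(1)] show ?thesis unfolding cantor_stage.simps by blast
    qed
  qed simp
  then show ?thesis using assms by (simp add: cantor_def)
qed

text \<open>
  The first ternary digits of a point of the Cantor set, with \<open>True\<close> for the digit 2. Two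
  points have the same address of length \<open>n\<close> when they lie in the same interval of the
  \<open>n\<close>-th stage. Equality of addresses replaces distance below because the involutions
  preserve it exactly, whereas \<open>flip_below\<close> is not an isometry.
\<close>
primrec addr :: "nat \<Rightarrow> real \<Rightarrow> bool list" where
  "addr 0 x = []"
| "addr (Suc n) x = (2 / 3 \<le> x) # addr n (if 2 / 3 \<le> x then 3 * x - 2 else 3 * x)"

lemma length_addr [simp]: "length (addr n x) = n"
  by (induction n arbitrary: x) auto

lemma addr_thirds [simp]:
  assumes "w \<in> cantor"
  shows "addr (Suc n) (w / 3) = False # addr n w" "addr (Suc n) (2 / 3 + w / 3) = True # addr n w"
  using cantor_bounds[OF assms] by auto

declare addr.simps(2) [simp del]

lemma addr_eq_imp_close:
  assumes "x \<in> cantor" "y \<in> cantor" "addr n x = addr n y"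
  shows "\<bar>x - y\<bar> \<le> (1/3) ^ n"
  using assms
proof (induction n arbitrary: x y)
  case 0
  then show ?case using cantor_bounds[of x] cantor_bounds[of y] by auto
next
  case (Suc n)
  note same = Suc.prems(3)
  from Suc.prems(1) show ?case
  proof (cases rule: cantor_cases)
    case x: (left v)
    from Suc.prems(2) show ?thesis
    proof (cases rule: cantor_cases)
      case y: (left w)
      have "\<bar>v - w\<bar> \<le> (1/3) ^ n"
        using same[unfolded x(2) y(2)] x(1) y(1) Suc.IH[of v w] by simp
      then show ?thesis unfolding x(2) y(2) by (simp flip: diff_divide_distrib)
    next
      case y: (right w)
      from same[unfolded x(2) y(2)] x(1) y(1) show ?thesis by simp
    qed
  next
    case x: (right v)
    from Suc.prems(2) show ?thesis
    proof (cases rule: cantor_cases)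
      case y: (left w)
      from same[unfolded x(2) y(2)] x(1) y(1) show ?thesis by simp
    next
      case y: (right w)
      have "\<bar>v - w\<bar> \<le> (1/3) ^ n"
        using same[unfolded x(2) y(2)] x(1) y(1) Suc.IH[of v w] by simp
      then show ?thesis unfolding x(2) y(2) by (simp flip: diff_divide_distrib)
    qed
  qed
qed

text \<open>
  Distinct intervals of a stage are separated by at least the length of one of them. The strict
  inequality matters: \<open>1 / 3\<close> and \<open>2 / 3\<close> are at distance exactly \<open>1 / 3\<close>.
\<close>
lemma close_imp_addr_eq:
  assumes "x \<in> cantor" "y \<in> cantor" "\<bar>x - y\<bar> < (1/3) ^ n"
  shows "addr n x = addr n y"
  using assms
proof (induction n arbitrary: x y)
  case (Suc n)
  have small: "\<bar>x - y\<bar> < 1 / 3"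
    using Suc.prems(3) power_le_one[of "1/3::real" n] by simp
  note close = Suc.prems(3)
  from Suc.prems(1) show ?case
  proof (cases rule: cantor_cases)
    case x: (left v)
    from Suc.prems(2) show ?thesis
    proof (cases rule: cantor_cases)
      case y: (left w)
      have "\<bar>v - w\<bar> < (1/3) ^ n"
        using close[unfolded x(2) y(2)] by (simp flip: diff_divide_distrib)
      then show ?thesis unfolding x(2) y(2) using x(1) y(1) Suc.IH[of v w] by simp
    next
      case y: (right w)
      with x small cantor_bounds[of v] cantor_bounds[of w] show ?thesis by linarith
    qed
  next
    case x: (right v)
    from Suc.prems(2) show ?thesis
    proof (cases rule: cantor_cases)
      case y: (left w)
      with x small cantor_bounds[of v] cantor_bounds[of w] show ?thesis by linarith
    next
      case y: (right w)
      have "\<bar>v - w\<bar> < (1/3) ^ n"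
        using close[unfolded x(2) y(2)] by (simp flip: diff_divide_distrib)
      then show ?thesis unfolding x(2) y(2) using x(1) y(1) Suc.IH[of v w] by simp
    qed
  qed
qed simp

text \<open>
  The address is locally constant. As \<open>B\<close> is arbitrary, this applied to \<open>B\<close> and to its
  complement gives a partition into two closed pieces.
\<close>
lemma closed_cylinders: "closed {y \<in> cantor. addr n y \<in> B}"
proof (rule closed_limpt[THEN iffD2], intro allI impI)
  fix y assume "y islimpt {y \<in> cantor. addr n y \<in> B}"
  then have y: "y \<in> closure {y \<in> cantor. addr n y \<in> B}" by (simp add: closure_def)
  then have "y \<in> closure cantor" by (rule subsetD[OF closure_mono, rotated]) blast
  then have yC: "y \<in> cantor" using compact_cantor by (simp add: compact_imp_closed)
  have "(1/3::real) ^ n > 0" by simp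
  with y obtain z where "z \<in> cantor" "addr n z \<in> B" "dist z y < (1/3) ^ n"
    unfolding closure_approachable by blast
  with close_imp_addr_eq[of z y n] yC show "y \<in> {y \<in> cantor. addr n y \<in> B}"
    by (auto simp: dist_real_def)
qed

text \<open>
  The set and its complement in the Cantor set are compact and disjoint, hence a positive distance
  apart, and fine enough intervals cannot meet both.
\<close>
lemma clopen_determined_by_addr:
  assumes "clopen_in cantor D"
  obtains n where "\<And>x y. x \<in> cantor \<Longrightarrow> y \<in> cantor \<Longrightarrow> addr n x = addr n y \<Longrightarrow> x \<in> D \<longleftrightarrow> y \<in> D"
proof -
  have "closedin (top_of_set cantor) D" "closedin (top_of_set cantor) (cantor - D)"
    using assms by (auto simp: clopen_in_def)
  then have "compact D" "closed (cantor - D)"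
    using compact_cantor closedin_compact closedin_closed_trans compact_imp_closed by blast+
  then obtain d where d: "d > 0" "\<And>x y. x \<in> D \<Longrightarrow> y \<in> cantor - D \<Longrightarrow> d \<le> dist x y"
    using separate_compact_closed[of D "cantor - D"] by blast
  obtain n where n: "(1/3::real) ^ n < d"
    using real_arch_pow_inv[of d "1/3"] d(1) by auto
  have sub: "y \<in> D" if "x \<in> D" "x \<in> cantor" "y \<in> cantor" "addr n x = addr n y" for x y
    using d(2)[of x y] addr_eq_imp_close[of x y n] that n by (force simp: dist_real_def)
  show ?thesis by (rule that[of n]) (use sub in metis)
qed

section \<open>Two involutions and the adding machine\<close>

definition flip_above :: "real \<Rightarrow> real" where
  "flip_above x = 1 - x"

text \<open>
  For \<open>0 < x\<close> in the Cantor set the exponent is the \<open>j > 0\<close> for which \<open>x\<close> lies in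
  \<open>[2 / 3 ^ j, 3 / 3 ^ j]\<close>. Fixing \<open>0\<close>, where no arc below the diagonal ends, makes the
  involution continuous: the other ends of the arcs ending near \<open>0\<close> are near \<open>0\<close>.
\<close>
definition flip_below :: "real \<Rightarrow> real" where
  "flip_below x = (if x = 0 then 0 else 5 / 3 ^ (LEAST i. 2 / 3 ^ i \<le> x) - x)"

text \<open>
  With the next lemma this describes \<open>flip_below\<close> recursively along the ternary digits: the arcs below the diagonal are copies, scaled by powers of
  \<open>1 / 3\<close>, of those that end in \<open>[2 / 3, 1]\<close>.
\<close>
lemma flip_below_third:
  assumes "w \<in> cantor"
  shows "flip_below (w / 3) = flip_below w / 3"
proof (cases "w = 0")
  case False
  with cantor_bounds[OF assms] have w: "0 < w" "w \<le> 1" by auto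
  obtain i where i: "(1/3::real) ^ i < w / 2"
    using real_arch_pow_inv[of "w/2" "1/3"] w by auto
  have "(LEAST i. 2 / 3 ^ i \<le> w / 3) = Suc (LEAST i. 2 / 3 ^ Suc i \<le> w / 3)"
  proof (rule Least_Suc)
    show "2 / 3 ^ Suc i \<le> w / 3" using i by (simp add: field_simps)
    show "\<not> 2 / 3 ^ 0 \<le> w / 3" using w by simp
  qed
  also have "(LEAST i. 2 / 3 ^ Suc i \<le> w / 3) = (LEAST i. 2 / 3 ^ i \<le> w)"
    by (simp add: field_simps)
  finally show ?thesis using w by (simp add: flip_below_def field_simps)
qed (simp add: flip_below_def)

lemma flip_below_right:
  assumes "w \<in> cantor"
  shows "flip_below (2 / 3 + w / 3) = 2 / 3 + (1 - w) / 3"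
proof -
  have w: "0 \<le> w" "w \<le> 1" using cantor_bounds[OF assms] by auto
  have "(LEAST i. 2 / 3 ^ i \<le> 2 / 3 + w / 3) = Suc 0"
  proof (rule Least_equality)
    fix i :: nat assume "2 / 3 ^ i \<le> 2 / 3 + w / 3"
    then show "Suc 0 \<le> i" using w by (cases i) auto
  qed (use w in simp)
  then show ?thesis using w by (simp add: flip_below_def field_simps)
qed

lemma flip_above_in_cantor: "x \<in> cantor \<Longrightarrow> flip_above x \<in> cantor"
  by (simp add: flip_above_def cantor_reflect)

lemma flip_above_above: "flip_above (flip_above x) = x"
  by (simp add: flip_above_def)

text \<open>
  Multiplying a nonzero point by 3 repeatedly must eventually move it into the right third, so a
  property can be proved there and propagated by scaling.
\<close>
lemma cantor_induct [consumes 2, case_names right left]: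
  assumes "x \<in> cantor" "x \<noteq> 0"
    and right: "\<And>w. w \<in> cantor \<Longrightarrow> P (2 / 3 + w / 3)"
    and left: "\<And>w. w \<in> cantor \<Longrightarrow> w \<noteq> 0 \<Longrightarrow> P w \<Longrightarrow> P (w / 3)"
  shows "P x"
proof -
  have "x > 0" using assms(1,2) cantor_bounds[of x] by auto
  then obtain n where "(1/3::real) ^ n < x"
    using real_arch_pow_inv[of x "1/3"] by auto
  with assms(1) show ?thesis
  proof (induction n arbitrary: x)
    case 0
    then show ?case using cantor_bounds[of x] by simp
  next
    case (Suc n)
    from Suc.prems(1) show ?case
    proof (cases rule: cantor_cases)
      case (left w)
      with Suc.prems(2) have "(1/3) ^ n < w" by simp
      moreover from this have "w \<noteq> 0" by (metis less_numeral_extra(3) order_less_le_trans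
        zero_le_power zero_le_divide_1_iff zero_le_numeral not_less)
      ultimately show ?thesis using left Suc.IH[of w] assms(4)[of w] by blast
    qed (use right in blast)
  qed
qed

lemma flip_below_zero [simp]: "flip_below 0 = 0"
  by (simp add: flip_below_def)

lemma flip_below_in_cantor: 
  assumes "x \<in> cantor"
  shows "flip_below x \<in> cantor"
proof (cases "x = 0")
  case False
  with assms show ?thesis
    by (induction rule: cantor_induct)
      (simp_all add: flip_below_right flip_below_third cantor_thirds cantor_reflect)
qed (simp add: zero_in_cantor)

lemma flip_below_below:
  assumes "x \<in> cantor"
  shows "flip_below (flip_below x) = x"
proof (cases "x = 0")
  case False
  with assms show ?thesis
    by (induction rule: cantor_induct)
      (simp_all add: flip_below_right flip_below_third cantor_reflect flip_below_in_cantor)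
qed simp

lemma addr_flip_above:
  assumes "x \<in> cantor"
  shows "addr n (flip_above x) = map Not (addr n x)"
  using assms
proof (induction n arbitrary: x)
  case (Suc n)
  from Suc.prems show ?case
  proof (cases rule: cantor_cases)
    case (left w)
    have flip: "flip_above (w / 3) = 2 / 3 + flip_above w / 3"
      by (simp add: flip_above_def field_simps)
    from left(1) Suc.IH[of w] show ?thesis
      unfolding left(2) flip by (simp add: flip_above_in_cantor)
  next
    case (right w)
    have flip: "flip_above (2 / 3 + w / 3) = flip_above w / 3"
      by (simp add: flip_above_def field_simps)
    from right(1) Suc.IH[of w] show ?thesis
      unfolding right(2) flip by (simp add: flip_above_in_cantor)
  qed
qed simp

text \<open>
  Negation of a binary number whose least significant bit comes first: the bits up to the first 1
  stay, those after it are complemented.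
\<close>
fun neg :: "bool list \<Rightarrow> bool list" where
  "neg [] = []"
| "neg (False # bs) = False # neg bs"
| "neg (True # bs) = True # map Not bs"

lemma addr_flip_below:
  assumes "x \<in> cantor"
  shows "addr n (flip_below x) = neg (addr n x)"
  using assms
proof (induction n arbitrary: x)
  case (Suc n)
  from Suc.prems show ?case
  proof (cases rule: cantor_cases)
    case (left w)
    with Suc.IH[of w] show ?thesis
      unfolding left(2) by (simp add: flip_below_third flip_below_in_cantor)
  next
    case (right w)
    with addr_flip_above[of w n] show ?thesis
      unfolding right(2) by (simp add: flip_below_right cantor_reflect flip_above_def)
  qed
qed simp

text \<open>
  The adding machine: adding 1 modulo \<open>2 ^ n\<close> to a number with \<open>n\<close> bits, the least
  significant one first.
\<close>
fun incr :: "bool list \<Rightarrow> bool list" where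
  "incr [] = []"
| "incr (False # bs) = True # bs"
| "incr (True # bs) = False # incr bs"

text \<open>
  In two's complement arithmetic, complementing all bits of \<open>b\<close> gives \<open>- b - 1\<close>, whose
  negative is \<open>b + 1\<close>.
\<close>
lemma neg_map_Not: "neg (map Not bs) = incr bs"
  by (induction bs rule: incr.induct) (simp_all add: comp_def)

lemma incr_funpow_double: "(incr ^^ (2 * k)) (False # bs) = False # (incr ^^ k) bs"
  by (induction k) simp_all

lemma length_incr: "length (incr bs) = length bs"
  by (induction bs rule: incr.induct) simp_all

text \<open>
  Two increments act on the remaining bits as one (\<open>incr_funpow_double\<close>), so induction
  on the length first adjusts the higher bits by an even number of steps and then, if necessary,
  the lowest bit by one more.
\<close>
lemma incr_transitive:
  assumes "length bs = length bs'"
  shows "\<exists>k. (incr ^^ k) bs = bs'"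
  using assms
proof (induction bs' arbitrary: bs)
  case Nil
  then have "(incr ^^ 0) bs = []" by simp
  then show ?case by blast
next
  case (Cons b' bs')
  have from_False: "\<exists>k. (incr ^^ k) (False # cs) = b' # bs'" if "length cs = length bs'" for cs
  proof -
    obtain k where k: "(incr ^^ k) cs = bs'" using Cons.IH \<open>length cs = length bs'\<close> by blast
    show ?thesis
    proof (cases b')
      case False
      then have "(incr ^^ (2 * k)) (False # cs) = b' # bs'"
        using k incr_funpow_double[of k cs] by simp
      then show ?thesis by blast
    next
      case True
      then have "(incr ^^ Suc (2 * k)) (False # cs) = b' # bs'"
        using k incr_funpow_double[of k cs] by simp
      then show ?thesis by blast
    qed
  qed
  obtain b cs where bs: "bs = b # cs" "length cs = length bs'"
    using Cons.prems by (cases bs) auto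
  show ?case
  proof (cases b)
    case False
    then show ?thesis using from_False[OF bs(2)] bs(1) by simp
  next
    case True
    obtain m where "(incr ^^ m) (incr bs) = b' # bs'"
      using from_False[of "incr cs"] True bs by (auto simp: length_incr)
    then have "(incr ^^ Suc m) bs = b' # bs'" by (simp add: funpow_swap1)
    then show ?thesis by blast
  qed
qed


lemma funpow_in_cantor:
  assumes "\<And>x. x \<in> cantor \<Longrightarrow> f x \<in> cantor" "x \<in> cantor"
  shows "(f ^^ k) x \<in> cantor"
  by (induction k) (simp_all add: assms)

lemma below_above_recurrence:
  assumes "x \<in> cantor" "length bs = n"
  shows "\<exists>k. addr n (((flip_below \<circ> flip_above) ^^ k) x) = bs"
proof -
  let ?T = "flip_below \<circ> flip_above"
  have "addr n ((?T ^^ k) x) = (incr ^^ k) (addr n x)" for k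
  proof (induction k)
    case (Suc k)
    have "(?T ^^ k) x \<in> cantor"
      by (rule funpow_in_cantor) (simp_all add: assms flip_below_in_cantor flip_above_in_cantor)
    then have "addr n (?T ((?T ^^ k) x)) = incr (addr n ((?T ^^ k) x))"
      by (simp add: addr_flip_below addr_flip_above flip_above_in_cantor neg_map_Not)
    moreover have "(?T ^^ Suc k) x = ?T ((?T ^^ k) x)" "(incr ^^ Suc k) (addr n x) = incr ((incr ^^ k) (addr n x))"
      by simp_all
    ultimately show ?case by (simp only: Suc.IH)
  qed simp
  then show ?thesis using incr_transitive[of "addr n x" bs] assms(2) by simp
qed

text \<open>
  The journey in the opposite direction: \<open>flip_above \<circ> flip_below\<close> is the inverse of the
  adding machine, and \<open>flip_above\<close> conjugates the one to the other.
\<close>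
lemma above_below_recurrence:
  assumes "x \<in> cantor" "length bs = n"
  shows "\<exists>k. addr n (((flip_above \<circ> flip_below) ^^ k) x) = bs"
proof -
  let ?T = "flip_below \<circ> flip_above"
  have conj: "((flip_above \<circ> flip_below) ^^ k) x = flip_above ((?T ^^ k) (flip_above x))" for k
    by (induction k) (simp_all add: flip_above_above)
  obtain k where k: "addr n ((?T ^^ k) (flip_above x)) = map Not bs"
    using below_above_recurrence[of "flip_above x" "map Not bs" n] assms flip_above_in_cantor by auto
  have "(?T ^^ k) (flip_above x) \<in> cantor"
    by (rule funpow_in_cantor) (simp_all add: assms flip_below_in_cantor flip_above_in_cantor)
  then have "addr n (((flip_above \<circ> flip_below) ^^ k) x) = map Not (map Not bs)"
    unfolding conj k[symmetric] by (rule addr_flip_above)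
  also have "\<dots> = bs" by (simp add: comp_def)
  finally show ?thesis by blast
qed

text \<open>
  Two involutions turn \<open>C\<close> into a graph whose components are chains with alternating
  \<open>f\<close>- and \<open>g\<close>-edges. Removing the \<open>f\<close>-edges at points of \<open>Z\<close> breaks the chains into
  finite blocks if every journey that begins with an \<open>f\<close>-edge reaches \<open>Z\<close>.
\<close>
lemma finite_block:
  assumes f: "\<And>x. x \<in> C \<Longrightarrow> f x \<in> C \<and> f (f x) = x"
    and g: "\<And>x. x \<in> C \<Longrightarrow> g x \<in> C \<and> g (g x) = x"
    and recur: "\<And>x. x \<in> C \<Longrightarrow> \<exists>k. ((g \<circ> f) ^^ k) x \<in> Z"
    and "x \<in> C"
  shows "\<exists>F. finite F \<and> F \<subseteq> C \<and> x \<in> F \<and> (\<forall>y\<in>F. g y \<in> F) \<and> (\<forall>y\<in>F. y \<notin> Z \<longrightarrow> f y \<in> F)"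
proof -
  \<comment> \<open>The half of the block that is reached from \<open>x\<close> by an \<open>f\<close>-edge; only the \<open>g\<close>-edge at
    \<open>x\<close> itself may leave it. The other half is the same thing started at \<open>g x\<close>.\<close>
  have forward: "\<exists>F. finite F \<and> F \<subseteq> C \<and> x \<in> F \<and> (\<forall>y\<in>F. y = x \<or> g y \<in> F) \<and>
      (\<forall>y\<in>F. y \<notin> Z \<longrightarrow> f y \<in> F)" if x: "x \<in> C" for x
  proof -
    define u where "u k = ((g \<circ> f) ^^ k) x" for k
    have uC: "u k \<in> C" for k by (induction k) (simp_all add: u_def x f g)
    have u0: "u 0 = x" and u_Suc: "u (Suc k) = g (f (u k))" for k by (simp_all add: u_def)
    obtain k where k: "u k \<in> Z" using recur[OF x] by (auto simp: u_def)
    define F where "F = u ` {..k} \<union> (\<lambda>j. f (u j)) ` {..<k}"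
    have "finite F" "F \<subseteq> C" using uC f by (auto simp: F_def)
    moreover have "x \<in> F" by (auto simp: F_def simp flip: u0)
    moreover have "y = x \<or> g y \<in> F" if "y \<in> F" for y
    proof -
      consider j where "j \<le> k" "y = u j" | j where "j < k" "y = f (u j)"
        using \<open>y \<in> F\<close> by (auto simp: F_def)
      then show ?thesis
      proof cases
        case (1 j)
        then show ?thesis
          using uC[of "j - 1"] f g by (cases j) (auto simp: F_def u0 u_Suc)
      next
        case (2 j)
        then have "g y = u (Suc j)" "Suc j \<le> k" by (simp_all add: u_Suc)
        then show ?thesis by (auto simp: F_def)
      qed
    qed
    moreover have "f y \<in> F" if y: "y \<in> F" "y \<notin> Z" for y
    proof -
      consider j where "j < k" "y = u j" | j where "j < k" "y = f (u j)"
        using y k by (fastforce simp: F_def le_less)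
      then show ?thesis
        by cases (use uC f in \<open>auto simp: F_def\<close>)
    qed
    ultimately show ?thesis by blast
  qed
  obtain F where F: "finite F" "F \<subseteq> C" "x \<in> F" "\<forall>y\<in>F. y = x \<or> g y \<in> F"
    "\<forall>y\<in>F. y \<notin> Z \<longrightarrow> f y \<in> F"
    using forward[OF \<open>x \<in> C\<close>] by (elim exE conjE)
  have gx: "g x \<in> C" "g (g x) = x" using g[OF \<open>x \<in> C\<close>] by simp_all
  obtain G where G: "finite G" "G \<subseteq> C" "g x \<in> G" "\<forall>y\<in>G. y = g x \<or> g y \<in> G"
    "\<forall>y\<in>G. y \<notin> Z \<longrightarrow> f y \<in> G"
    using forward[OF gx(1)] by (elim exE conjE)
  have "\<forall>y\<in>F \<union> G. g y \<in> F \<union> G"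
    using F(3,4) G(3,4) gx(2) by (metis Un_iff)
  moreover have "\<forall>y\<in>F \<union> G. y \<notin> Z \<longrightarrow> f y \<in> F \<union> G"
    using F(5) G(5) by blast
  ultimately show ?thesis
    using F(1,2,3) G(1,2) by (intro exI[of _ "F \<union> G"]) auto
qed

section \<open>The endpoints of the arcs\<close>

text \<open>The abscissae of the diagonal points where the arc \<open>\<phi> j (c, _)\<close> starts and ends.\<close>
definition lo :: "nat \<Rightarrow> real \<Rightarrow> real" where
  "lo j c = (if j = 0 then c / 3 else 2 / 3 ^ j + c / 3 ^ (j + 1))"

definition hi :: "nat \<Rightarrow> real \<Rightarrow> real" where
  "hi j c = (if j = 0 then 1 else 5 / 3 ^ j) - lo j c"

definition flip :: "nat \<Rightarrow> real \<Rightarrow> real" where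
  "flip j = (if j = 0 then flip_above else flip_below)"

lemma lo_Suc_Suc: "lo (Suc (Suc j)) c = lo (Suc j) c / 3"
  and hi_Suc_Suc: "hi (Suc (Suc j)) c = hi (Suc j) c / 3"
  by (simp_all add: lo_def hi_def field_simps)

lemma lo_one: "lo (Suc 0) c = 2 / 3 + (c / 3) / 3"
  and hi_one: "hi (Suc 0) c = 2 / 3 + (1 - c / 3) / 3"
  by (simp_all add: lo_def hi_def field_simps)

lemma lo_in_cantor:
  assumes "c \<in> cantor"
  shows "lo j c \<in> cantor"
proof -
  have "lo (Suc i) c \<in> cantor" for i
    by (induction i) (simp_all only: lo_one lo_Suc_Suc assms cantor_thirds)
  then show ?thesis using cantor_thirds[OF assms] by (cases j) (simp_all add: lo_def)
qed

lemma flip_in_cantor: "x \<in> cantor \<Longrightarrow> flip j x \<in> cantor"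
  by (simp add: flip_def flip_above_in_cantor flip_below_in_cantor)

lemma flip_flip: "x \<in> cantor \<Longrightarrow> flip j (flip j x) = x"
  by (simp add: flip_def flip_above_above flip_below_below)

lemma flip_lo:
  assumes "c \<in> cantor"
  shows "flip j (lo j c) = hi j c"
proof (cases j)
  case 0
  then show ?thesis by (simp add: flip_def flip_above_def hi_def)
next
  case (Suc i)
  have "flip_below (lo (Suc i) c) = hi (Suc i) c"
  proof (induction i)
    case 0
    show ?case
      unfolding lo_one hi_one by (rule flip_below_right) (simp add: cantor_thirds assms)
  next
    case (Suc i)
    then show ?case
      by (simp add: lo_Suc_Suc hi_Suc_Suc flip_below_third lo_in_cantor assms)
  qed
  then show ?thesis using Suc by (simp add: flip_def)
qed

lemma hi_in_cantor: "c \<in> cantor \<Longrightarrow> hi j c \<in> cantor"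
  using flip_lo[of c j] flip_in_cantor[of "lo j c" j] lo_in_cantor[of c j] by simp

lemma flip_hi: "c \<in> cantor \<Longrightarrow> flip j (hi j c) = lo j c"
  using flip_lo[of c j] flip_flip[of "lo j c" j] lo_in_cantor[of c j] by simp

text \<open>
  The arcs above the diagonal end at all of its points, and those below it at all points except
  the origin; so invariance under the arcs is invariance under both involutions.
\<close>
lemma cantor_endpoint_above:
  assumes "x \<in> cantor"
  shows "\<exists>c\<in>cantor. x = lo 0 c \<or> x = hi 0 c"
  using assms
proof (cases rule: cantor_cases)
  case (left w)
  then have "x = lo 0 w" by (simp add: lo_def)
  then show ?thesis using left by blast
next
  case (right w)
  then have "x = hi 0 (1 - w)" by (simp add: lo_def hi_def field_simps)
  then show ?thesis using right cantor_reflect by blast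
qed

lemma cantor_endpoint_below:
  assumes "x \<in> cantor" "x \<noteq> 0"
  shows "\<exists>j>0. \<exists>c\<in>cantor. x = lo j c \<or> x = hi j c"
  using assms
proof (induction rule: cantor_induct)
  case (right w)
  from right show ?case
  proof (cases rule: cantor_cases)
    case (left v)
    then have "2 / 3 + w / 3 = lo (Suc 0) v" by (simp add: lo_one)
    then show ?thesis using left(1) zero_less_Suc by metis
  next
    case v: (right v)
    then have "2 / 3 + w / 3 = hi (Suc 0) (1 - v)" by (simp add: hi_one field_simps)
    then show ?thesis using cantor_reflect[OF v(1)] zero_less_Suc by metis
  qed
next
  case (left w)
  then obtain j c where "c \<in> cantor" "w = lo (Suc j) c \<or> w = hi (Suc j) c"
    by (metis gr0_implies_Suc)
  then have "w / 3 = lo (Suc (Suc j)) c \<or> w / 3 = hi (Suc (Suc j)) c"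
    by (auto simp: lo_Suc_Suc hi_Suc_Suc)
  then show ?case using \<open>c \<in> cantor\<close> zero_less_Suc by metis
qed

lemma flip_invariant:
  assumes D: "\<And>j c. c \<in> cantor \<Longrightarrow> lo j c \<in> D \<longleftrightarrow> hi j c \<in> D" and "x \<in> cantor"
  shows "flip_above x \<in> D \<longleftrightarrow> x \<in> D" "flip_below x \<in> D \<longleftrightarrow> x \<in> D"
proof -
  obtain c where "c \<in> cantor" "x = lo 0 c \<or> x = hi 0 c"
    using cantor_endpoint_above[OF \<open>x \<in> cantor\<close>] by blast
  then show "flip_above x \<in> D \<longleftrightarrow> x \<in> D"
    using D[of c 0] flip_lo[of c 0] flip_hi[of c 0] by (auto simp: flip_def)
  show "flip_below x \<in> D \<longleftrightarrow> x \<in> D"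
  proof (cases "x = 0")
    case False
    then obtain j c where "j > 0" "c \<in> cantor" "x = lo j c \<or> x = hi j c"
      using cantor_endpoint_below[OF \<open>x \<in> cantor\<close>] by blast
    then show ?thesis
      using D[of c j] flip_lo[of c j] flip_hi[of c j] by (auto simp: flip_def)
  qed simp
qed

text \<open>
  Membership depends on finitely many bits, and by recurrence the orbit of a point of \<open>D\<close> under
  the adding machine realises every pattern of these bits.
\<close>
lemma invariant_clopen_trivial:
  assumes "clopen_in cantor D" "D \<noteq> {}"
    and D: "\<And>j c. c \<in> cantor \<Longrightarrow> lo j c \<in> D \<longleftrightarrow> hi j c \<in> D"
  shows "D = cantor"
proof -
  have "D \<subseteq> cantor" using assms(1) by (auto simp: clopen_in_def dest: openin_imp_subset)
  moreover have "y \<in> D" if "y \<in> cantor" for y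
  proof -
    obtain x where x: "x \<in> D" "x \<in> cantor" using assms(2) \<open>D \<subseteq> cantor\<close> by blast
    obtain n where n: "\<And>x y. x \<in> cantor \<Longrightarrow> y \<in> cantor \<Longrightarrow> addr n x = addr n y \<Longrightarrow> x \<in> D \<longleftrightarrow> y \<in> D"
      using clopen_determined_by_addr[OF assms(1)] by blast
    obtain k where k: "addr n (((flip_below \<circ> flip_above) ^^ k) x) = addr n y"
      using below_above_recurrence[OF x(2), of "addr n y" n] by auto
    have "((flip_below \<circ> flip_above) ^^ k) x \<in> D \<inter> cantor"
      by (induction k)
        (use x flip_invariant[of D] D in \<open>simp_all add: flip_above_in_cantor flip_below_in_cantor\<close>)
    then show ?thesis using n[OF _ that k] by blast
  qed
  ultimately show ?thesis by blast
qed

lemma addr_flip_cong: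
  assumes "x \<in> cantor" "y \<in> cantor" "addr n x = addr n y"
  shows "addr n (flip j x) = addr n (flip j y)"
  using assms by (simp add: flip_def addr_flip_above addr_flip_below)

lemma addr_take: "n \<le> m \<Longrightarrow> take n (addr m x) = addr n x"
proof (induction n arbitrary: m x)
  case (Suc n)
  then show ?case by (cases m) (auto simp: addr.simps)
qed simp

text \<open>
  The block of \<open>x\<close> when all arcs of the family of \<open>\<phi> i (c0, _)\<close> with endpoints in the
  cylinders of level \<open>n\<close> around its endpoints are cut. The involutions act on addresses, so for
  \<open>m \<ge> n\<close> the union of the level \<open>m\<close> cylinders around the block is closed under the uncut
  arcs as well. An involution does not see the index of an arc beyond the side of the diagonal on
  which it lies, which explains the condition \<open>j = 0 \<longleftrightarrow> i = 0\<close>; for fine cylinders it amounts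
  to \<open>j = i\<close> (\<open>near_endpoint_same_arc\<close>).
\<close>
lemma finite_block_of_endpoints:
  assumes "c0 \<in> cantor" "x \<in> cantor"
    and Z: "Z = {y. addr n y = addr n (lo i c0) \<or> addr n y = addr n (hi i c0)}"
  obtains F where "finite F" "F \<subseteq> cantor" "x \<in> F"
    "\<And>m j c. n \<le> m \<Longrightarrow> c \<in> cantor \<Longrightarrow> \<not> ((j = 0 \<longleftrightarrow> i = 0) \<and> lo j c \<in> Z) \<Longrightarrow>
       addr m (lo j c) \<in> addr m ` F \<longleftrightarrow> addr m (hi j c) \<in> addr m ` F"
proof -
  define f g where fg_def: "f = flip i" "g = (if i = 0 then flip_below else flip_above)"
  then have fg: "f = flip_above \<and> g = flip_below \<or> f = flip_below \<and> g = flip_above"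
    by (auto simp: flip_def)
  have recur: "\<exists>k. ((g \<circ> f) ^^ k) y \<in> Z" if "y \<in> cantor" for y
    using fg below_above_recurrence[OF that, of "addr n (lo i c0)" n]
      above_below_recurrence[OF that, of "addr n (lo i c0)" n] by (auto simp: Z)
  have f: "f y \<in> cantor \<and> f (f y) = y" and g: "g y \<in> cantor \<and> g (g y) = y" if "y \<in> cantor" for y
    using fg that
    by (auto simp: flip_above_in_cantor flip_below_in_cantor flip_above_above flip_below_below)
  from finite_block[of cantor f g Z x, OF f g recur \<open>x \<in> cantor\<close>]
  obtain F where F: "finite F" "F \<subseteq> cantor" "x \<in> F"
    "\<And>y. y \<in> F \<Longrightarrow> g y \<in> F" "\<And>y. y \<in> F \<Longrightarrow> y \<notin> Z \<Longrightarrow> f y \<in> F"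
    by blast
  have flip_F: "flip j u \<in> F" if "u \<in> F" "\<not> ((j = 0 \<longleftrightarrow> i = 0) \<and> u \<in> Z)" for j u
  proof (cases "j = 0 \<longleftrightarrow> i = 0")
    case True
    then have "flip j = f" by (auto simp: fg_def flip_def)
    then show ?thesis using that True F(5) by simp
  next
    case False
    then have "flip j = g" by (auto simp: fg_def flip_def)
    then show ?thesis using that F(4) by simp
  qed
  have Z_addr: "u \<in> Z \<longleftrightarrow> y \<in> Z" if "addr m u = addr m y" "n \<le> m" for u y m
    using that addr_take[OF that(2), of u] addr_take[OF that(2), of y] by (simp add: Z)
  have step: "addr m (flip j y) \<in> addr m ` F"
    if y: "n \<le> m" "y \<in> cantor" "\<not> ((j = 0 \<longleftrightarrow> i = 0) \<and> y \<in> Z)" "addr m y \<in> addr m ` F" for m j y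
  proof -
    obtain u where u: "u \<in> F" "addr m u = addr m y" using y(4) by force
    then have "flip j u \<in> F" using flip_F[of u j] y(1,3) Z_addr[of m u y] by blast
    moreover have "addr m (flip j u) = addr m (flip j y)"
      using u y(2) F(2) by (intro addr_flip_cong) auto
    ultimately show ?thesis by (metis image_eqI)
  qed
  have "addr m (lo j c) \<in> addr m ` F \<longleftrightarrow> addr m (hi j c) \<in> addr m ` F"
    if m: "n \<le> m" and c: "c \<in> cantor" and uncut: "\<not> ((j = 0 \<longleftrightarrow> i = 0) \<and> lo j c \<in> Z)" for m j c
  proof -
    have "lo j c \<in> Z" if "hi j c \<in> Z" "j = 0 \<longleftrightarrow> i = 0"
    proof -
      have "flip j = flip i" using that(2) by (simp add: flip_def)
      then have "flip j (hi j c) = lo j c" "flip j (lo i c0) = hi i c0" "flip j (hi i c0) = lo i c0"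
        using flip_hi[OF c, of j] flip_lo[OF \<open>c0 \<in> cantor\<close>, of i] flip_hi[OF \<open>c0 \<in> cantor\<close>, of i]
        by simp_all
      moreover have "addr n (flip j (hi j c)) = addr n (flip j (lo i c0)) \<or>
          addr n (flip j (hi j c)) = addr n (flip j (hi i c0))"
        using that(1) addr_flip_cong[OF hi_in_cantor[OF c] lo_in_cantor[OF \<open>c0 \<in> cantor\<close>], of n j i j]
          addr_flip_cong[OF hi_in_cantor[OF c] hi_in_cantor[OF \<open>c0 \<in> cantor\<close>], of n j i j]
        unfolding Z by blast
      ultimately show ?thesis unfolding Z by auto
    qed
    moreover have "addr m (hi j c) \<in> addr m ` F"
      if "\<not> ((j = 0 \<longleftrightarrow> i = 0) \<and> lo j c \<in> Z)" "addr m (lo j c) \<in> addr m ` F"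
      using step[OF m lo_in_cantor[OF c] that] by (simp add: flip_lo c)
    moreover have "addr m (lo j c) \<in> addr m ` F"
      if "\<not> ((j = 0 \<longleftrightarrow> i = 0) \<and> hi j c \<in> Z)" "addr m (hi j c) \<in> addr m ` F"
      using step[OF m hi_in_cantor[OF c] that] by (simp add: flip_hi c)
    ultimately show ?thesis using uncut by argo
  qed
  with F(1-3) show ?thesis by (rule that)
qed


section \<open>The arcs of the continuum\<close>

text \<open>
  One formula for both legs of an arc: one coordinate moves while \<open>t \<le> 1 / 2\<close>, the other one
  afterwards.
\<close>
lemma \<phi>_eq:
  "\<phi> j (c, t) =
    (if j = 0
     then (lo j c + max 0 (2 * t - 1) * (hi j c - lo j c), lo j c + min 1 (2 * t) * (hi j c - lo j c))
     else (lo j c + min 1 (2 * t) * (hi j c - lo j c), lo j c + max 0 (2 * t - 1) * (hi j c - lo j c)))"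
proof (cases "t \<le> 1 / 2")
  case True
  then have "max 0 (2 * t - 1) = 0" "min 1 (2 * t) = 2 * t" by simp_all
  with True show ?thesis by (simp add: \<phi>_def lo_def hi_def Let_def)
next
  case False
  then have "max 0 (2 * t - 1) = 2 * t - 1" "min 1 (2 * t) = 1" by simp_all
  with False show ?thesis by (simp add: \<phi>_def lo_def hi_def Let_def)
qed

lemma \<phi>_endpoints: "\<phi> j (c, 0) = (lo j c, lo j c)" "\<phi> j (c, 1) = (hi j c, hi j c)"
  by (simp_all add: \<phi>_eq)

lemma continuous_lo_hi: "continuous_on A (lo j)" "continuous_on A (hi j)"
  unfolding lo_def hi_def by (cases "j = 0"; auto intro!: continuous_intros)+

lemma continuous_\<phi>: "continuous_on A (\<phi> j)"
proof -
  have "\<phi> j = (\<lambda>p. \<phi> j (fst p, snd p))" by simp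
  moreover have "continuous_on A (\<lambda>p. \<phi> j (fst p, snd p))"
  proof -
    have "continuous_on A (\<lambda>p. lo j (fst p))" "continuous_on A (\<lambda>p. hi j (fst p))"
      by (rule continuous_on_compose2[OF continuous_lo_hi(1)[of UNIV]]
          continuous_on_compose2[OF continuous_lo_hi(2)[of UNIV]]; auto intro: continuous_intros)+
    then show ?thesis unfolding \<phi>_eq by (cases "j = 0") (simp_all add: continuous_intros)
  qed
  ultimately show ?thesis by simp
qed

text \<open>
  All starting points of the family \<open>j\<close> lie in the left third and all end points in the right
  third of one interval of length \<open>1 / 3 ^ j\<close> (or \<open>1\<close> if \<open>j = 0\<close>), so an arc does not start
  near the place where a parallel one ends.
\<close>
lemma lo_hi_gap:
  assumes "c \<in> cantor" "c' \<in> cantor"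
  shows "lo j c + 1 / 3 ^ (j + 1) \<le> hi j c'"
proof -
  define e :: real where "e = 1 / 3 ^ (j + 1)"
  have "e > 0" by (simp add: e_def)
  then have "c * e \<le> e" "c' * e \<le> e"
    using cantor_bounds assms by (simp_all add: mult_left_le_one_le)
  moreover have "lo j c = (if j = 0 then 0 else 6 * e) + c * e"
    "hi j c' = (if j = 0 then 3 * e else 9 * e) - c' * e"
    by (simp_all add: lo_def hi_def e_def field_simps)
  ultimately show ?thesis unfolding e_def[symmetric] by (auto split: if_splits)
qed

lemma lo_less_hi: "c \<in> cantor \<Longrightarrow> lo j c < hi j c"
  using lo_hi_gap[of c c j] zero_less_power[of "3::real" "j + 1"]
  by (smt (verit) divide_pos_pos)

lemma lo_hi_range:
  assumes "c \<in> cantor" "j > 0"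
  shows "2 / 3 ^ j \<le> lo j c" "hi j c \<le> 3 / 3 ^ j"
proof -
  have "0 \<le> c" "c \<le> 1" using cantor_bounds assms by auto
  then show "2 / 3 ^ j \<le> lo j c" "hi j c \<le> 3 / 3 ^ j"
    using assms(2) by (simp_all add: lo_def hi_def field_simps)
qed

lemma lo_diff: "\<bar>lo j c - lo j c'\<bar> = \<bar>c - c'\<bar> / 3 ^ (j + 1)"
proof -
  have "lo j c - lo j c' = (c - c') / 3 ^ (j + 1)"
    by (simp add: lo_def field_simps)
  then show ?thesis by simp
qed

lemma inj_lo: "inj (lo j)"
proof (rule injI)
  fix x y assume "lo j x = lo j y"
  then show "x = y" using lo_diff[of j x y] by simp
qed

lemma inj_hi: "inj (hi j)"
  by (rule injI) (simp add: hi_def inj_lo[THEN injD])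

lemma \<phi>_in_box:
  assumes "c \<in> cantor" "t \<in> {0..1}"
  shows "fst (\<phi> j (c, t)) \<in> {lo j c..hi j c}" "snd (\<phi> j (c, t)) \<in> {lo j c..hi j c}"
proof -
  define d where "d = hi j c - lo j c"
  have "d > 0" using lo_less_hi[OF assms(1), of j] by (simp add: d_def)
  then have "0 \<le> r * d \<and> r * d \<le> d" if "0 \<le> r" "r \<le> 1" for r
    using that by (simp add: mult_left_le_one_le)
  moreover have "0 \<le> max 0 (2 * t - 1)" "max 0 (2 * t - 1) \<le> 1" "0 \<le> min 1 (2 * t)" "min 1 (2 * t) \<le> 1"
    using assms(2) by auto
  ultimately have "0 \<le> max 0 (2 * t - 1) * d" "max 0 (2 * t - 1) * d \<le> d"
    "0 \<le> min 1 (2 * t) * d" "min 1 (2 * t) * d \<le> d" by blast+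
  then show "fst (\<phi> j (c, t)) \<in> {lo j c..hi j c}" "snd (\<phi> j (c, t)) \<in> {lo j c..hi j c}"
    unfolding \<phi>_eq d_def by auto
qed

lemma \<phi>_side:
  assumes "c \<in> cantor" "t \<in> {0..1}"
  shows "j = 0 \<Longrightarrow> fst (\<phi> j (c, t)) \<le> snd (\<phi> j (c, t))"
    "j > 0 \<Longrightarrow> snd (\<phi> j (c, t)) \<le> fst (\<phi> j (c, t))"
    "fst (\<phi> j (c, t)) = snd (\<phi> j (c, t)) \<longleftrightarrow> t = 0 \<or> t = 1"
proof -
  have d: "hi j c - lo j c > 0" using lo_less_hi[OF assms(1), of j] by simp
  have le: "max 0 (2 * t - 1) \<le> min 1 (2 * t)" using assms(2) by auto
  have eq: "max 0 (2 * t - 1) = min 1 (2 * t) \<longleftrightarrow> t = 0 \<or> t = 1"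
    using assms(2) by (auto simp: max_def min_def split: if_splits)
  from d le have "max 0 (2 * t - 1) * (hi j c - lo j c) \<le> min 1 (2 * t) * (hi j c - lo j c)"
    by (intro mult_right_mono) auto
  then show "j = 0 \<Longrightarrow> fst (\<phi> j (c, t)) \<le> snd (\<phi> j (c, t))"
    "j > 0 \<Longrightarrow> snd (\<phi> j (c, t)) \<le> fst (\<phi> j (c, t))"
    by (simp_all add: \<phi>_eq)
  show "fst (\<phi> j (c, t)) = snd (\<phi> j (c, t)) \<longleftrightarrow> t = 0 \<or> t = 1"
    using d eq by (auto simp: \<phi>_eq)
qed

text \<open>
  The numbers \<open>l\<close> and \<open>s - l\<close> are the endpoints of an arc and the equations compare the two
  coordinates of points on two arcs with the same \<open>s\<close>. Either the smaller coordinate is still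
  \<open>l\<close> or the larger one is already \<open>s - l\<close>; and arcs with larger \<open>l\<close> are nested inside,
  with all their coordinates between \<open>l\<close> and \<open>s - l\<close>.
\<close>
lemma corner_injective:
  fixes l l' s t t' :: real
  assumes "l < s - l" "l' < s - l'" "t \<in> {0..1}" "t' \<in> {0..1}"
    and A: "l + min 1 (2 * t) * (s - 2 * l) = l' + min 1 (2 * t') * (s - 2 * l')"
    and B: "l + max 0 (2 * t - 1) * (s - 2 * l) = l' + max 0 (2 * t' - 1) * (s - 2 * l')"
  shows "l = l' \<and> t = t'"
proof -
  have not_less: "\<not> l < l'"
    if "l < s - l" "l' < s - l'" "t \<in> {0..1}" "t' \<in> {0..1}"
      "l + min 1 (2 * t) * (s - 2 * l) = l' + min 1 (2 * t') * (s - 2 * l')"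
      "l + max 0 (2 * t - 1) * (s - 2 * l) = l' + max 0 (2 * t' - 1) * (s - 2 * l')"
    for l l' t t' :: real
  proof
    assume "l < l'"
    define P Q where "P = min 1 (2 * t') * (s - 2 * l')" and "Q = max 0 (2 * t' - 1) * (s - 2 * l')"
    have "0 \<le> Q" using that by (simp add: Q_def)
    have "P \<le> 1 * (s - 2 * l')"
      unfolding P_def using that by (intro mult_right_mono) auto
    then have "P \<le> s - 2 * l'" by simp
    consider "max 0 (2 * t - 1) = 0" | "min 1 (2 * t) = 1" by linarith
    then show False
    proof cases
      case 1
      then have "l = l' + Q" using that(6) by (simp add: Q_def)
      with \<open>0 \<le> Q\<close> \<open>l < l'\<close> show False by linarith
    next
      case 2
      then have "l + (s - 2 * l) = l' + P" using that(5) by (simp add: P_def)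
      with \<open>P \<le> s - 2 * l'\<close> \<open>l < l'\<close> show False by linarith
    qed
  qed
  have "l = l'"
    using not_less[of l l' t t'] not_less[of l' l t' t] assms by force
  with A B assms(1) have "min 1 (2 * t) = min 1 (2 * t')" "max 0 (2 * t - 1) = max 0 (2 * t' - 1)"
    by auto
  moreover have "min 1 (2 * r) + max 0 (2 * r - 1) = 2 * r" if "r \<in> {0..1}" for r :: real
    using that by auto
  ultimately have "2 * t = 2 * t'" using assms(3,4) by metis
  with \<open>l = l'\<close> show ?thesis by simp
qed

text \<open>
  The side of the diagonal tells whether \<open>j = 0\<close>; otherwise the coordinates lie in
  \<open>[2 / 3 ^ j, 3 / 3 ^ j]\<close>, and these intervals are disjoint. An interior point of an arc does not
  lie on the diagonal, which is why \<open>t'\<close> may be allowed to be an endpoint.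
\<close>
lemma \<phi>_inject:
  assumes c: "c \<in> cantor" "c' \<in> cantor" and t: "t \<in> {0<..<1}" "t' \<in> {0..1}"
    and eq: "\<phi> j (c, t) = \<phi> j' (c', t')"
  shows "j = j' \<and> c = c' \<and> t = t'"
proof -
  have t1: "t \<in> {0..1}" using t by auto
  have off: "fst (\<phi> j (c, t)) \<noteq> snd (\<phi> j (c, t))" using \<phi>_side(3)[OF c(1) t1, of j] t by auto
  have zero: "j = 0 \<longleftrightarrow> j' = 0"
    using off eq \<phi>_side(1,2)[OF c(1) t1, of j] \<phi>_side(1,2)[OF c(2) t(2), of j'] by fastforce
  have "j = j'"
  proof (rule ccontr)
    assume "j \<noteq> j'"
    with zero have pos: "j > 0" "j' > 0" by auto
    have p: "fst (\<phi> j (c, t)) \<in> {2 / 3 ^ j..3 / 3 ^ j}" "fst (\<phi> j (c, t)) \<in> {2 / 3 ^ j'..3 / 3 ^ j'}"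
      using \<phi>_in_box(1)[OF c(1) t1, of j] lo_hi_range[OF c(1) pos(1)]
        \<phi>_in_box(1)[OF c(2) t(2), of j'] lo_hi_range[OF c(2) pos(2)] eq by auto
    have sep: "(3::real) / 3 ^ n < 2 / 3 ^ m" if "m < n" for m n :: nat
    proof -
      have "(3::real) ^ Suc m \<le> 3 ^ n" using that by (intro power_increasing) auto
      then have "(3::real) / 3 ^ n \<le> 3 / 3 ^ Suc m" by (intro divide_left_mono) auto
      also have "\<dots> < 2 / 3 ^ m" by (simp add: divide_strict_right_mono)
      finally show ?thesis .
    qed
    consider "j < j'" | "j' < j" using \<open>j \<noteq> j'\<close> by linarith
    then show False
    proof cases
      case 1
      from sep[OF this] p show False unfolding atLeastAtMost_iff by linarith
    next
      case 2
      from sep[OF this] p show False unfolding atLeastAtMost_iff by linarith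
    qed
  qed
  define s :: real where "s = (if j = 0 then 1 else 5 / 3 ^ j)"
  have hi: "hi j x = s - lo j x" for x by (simp add: hi_def s_def)
  have width: "s - 2 * lo j x = hi j x - lo j x" for x by (simp add: hi)
  have "lo j c < s - lo j c" "lo j c' < s - lo j c'"
    using lo_less_hi[OF c(1), of j] lo_less_hi[OF c(2), of j] by (simp_all add: hi)
  moreover have "lo j c + min 1 (2 * t) * (s - 2 * lo j c) = lo j c' + min 1 (2 * t') * (s - 2 * lo j c')"
    "lo j c + max 0 (2 * t - 1) * (s - 2 * lo j c) = lo j c' + max 0 (2 * t' - 1) * (s - 2 * lo j c')"
    using eq \<open>j = j'\<close> unfolding width by (auto simp: \<phi>_eq split: if_splits)
  ultimately have "lo j c = lo j c' \<and> t = t'"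
    using t1 t(2) by (intro corner_injective[of _ s])
  then show ?thesis using \<open>j = j'\<close> inj_lo[THEN injD] by blast
qed

lemma norm_\<phi>_le:
  assumes "c \<in> cantor" "t \<in> {0..1}" "j > 0"
  shows "norm (\<phi> j (c, t)) \<le> 6 / 3 ^ j"
proof -
  have "2 / 3 ^ j \<ge> (0::real)" by simp
  then have "\<bar>fst (\<phi> j (c, t))\<bar> \<le> 3 / 3 ^ j" "\<bar>snd (\<phi> j (c, t))\<bar> \<le> 3 / 3 ^ j"
    using \<phi>_in_box[OF assms(1,2), of j] lo_hi_range[OF assms(1,3)] by auto
  then show ?thesis
    using norm_Pair_le[of "fst (\<phi> j (c, t))" "snd (\<phi> j (c, t))"] by simp
qed

text \<open>
  The families of arcs shrink to the origin, so a union of compact pieces, one in each family, can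
  have no limit point outside of itself other than the origin.
\<close>
lemma closed_union_of_arcs:
  assumes R: "\<And>j. compact (R j)" "\<And>j. R j \<subseteq> cantor \<times> {0..1}"
    and origin: "(0, 0) \<in> (\<Union>j. \<phi> j ` R j) \<or> (\<exists>N. \<forall>j\<ge>N. R j = {})"
  shows "closed (\<Union>j. \<phi> j ` R j)"
proof -
  have finite_part: "closed (\<Union>j<N. \<phi> j ` R j)" for N :: nat
    by (intro closed_UN ballI compact_imp_closed compact_continuous_image continuous_\<phi> R finite_lessThan)
  have split: "(\<Union>j. \<phi> j ` R j) = (\<Union>j<N. \<phi> j ` R j) \<union> (\<Union>j\<in>{N..}. \<phi> j ` R j)" for N
  proof -
    have "UNIV = {..<N} \<union> {N..}" by auto
    then show ?thesis by (metis UN_Un)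
  qed
  from origin show ?thesis
  proof
    assume "\<exists>N. \<forall>j\<ge>N. R j = {}"
    then obtain N where "\<forall>j\<ge>N. R j = {}" by blast
    then have "(\<Union>j. \<phi> j ` R j) = (\<Union>j<N. \<phi> j ` R j)" unfolding split[of N] by auto
    then show ?thesis using finite_part by simp
  next
    assume zero: "(0, 0) \<in> (\<Union>j. \<phi> j ` R j)"
    have "p \<in> (\<Union>j. \<phi> j ` R j)" if p: "p \<in> closure (\<Union>j. \<phi> j ` R j)" for p
    proof (cases "p = (0, 0)")
      case False
      then have "norm p > 0" by (simp add: zero_prod_def)
      then obtain N where N: "(1/3::real) ^ N < norm p / 6"
        using real_arch_pow_inv[of "norm p / 6" "1/3"] by auto
      have "(\<Union>j\<in>{Suc N..}. \<phi> j ` R j) \<subseteq> cball 0 (6 * (1/3) ^ N)"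
      proof
        fix q assume "q \<in> (\<Union>j\<in>{Suc N..}. \<phi> j ` R j)"
        then obtain j c t where q: "q = \<phi> j (c, t)" "Suc N \<le> j" "(c, t) \<in> R j" by auto
        then have "norm (\<phi> j (c, t)) \<le> 6 / 3 ^ j" using R(2)[of j] by (intro norm_\<phi>_le) auto
        also have "\<dots> = 6 * (1/3) ^ j" by (simp add: power_divide)
        also have "\<dots> \<le> 6 * (1/3) ^ N"
          using q(2) by (intro mult_left_mono power_decreasing) auto
        finally show "q \<in> cball 0 (6 * (1/3) ^ N)" using q(1) by simp
      qed
      then have "closure (\<Union>j\<in>{Suc N..}. \<phi> j ` R j) \<subseteq> cball 0 (6 * (1/3) ^ N)"
        by (intro closure_minimal) auto
      moreover have "p \<notin> cball 0 (6 * (1/3) ^ N)" using N by simp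
      ultimately have "p \<in> closure (\<Union>j<Suc N. \<phi> j ` R j)"
        using p unfolding split[of "Suc N"] closure_Un by blast
      then have "p \<in> (\<Union>j<Suc N. \<phi> j ` R j)" using finite_part by (simp only: closure_closed)
      then show ?thesis by blast
    qed (use zero in simp)
    then show ?thesis unfolding closure_subset_eq[symmetric] by (rule subsetI)
  qed
qed


section \<open>Connectedness\<close>

lemma closure_dense_part:
  fixes X :: "(real \<times> real) set"
  assumes "cantor \<times> {0<..<1} \<subseteq> closure X"
  shows "cantor \<times> {0..1} \<subseteq> closure X"
proof -
  have "closure (cantor \<times> {0<..<1::real}) = cantor \<times> {0..1}"
    using compact_cantor by (simp add: closure_Times compact_imp_closed)
  then show ?thesis using closure_minimal[OF assms closed_closure] by simp
qed

lemma W_arc_memI: "(c, t) \<in> X \<Longrightarrow> \<phi> j (c, t) \<in> W X"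
  unfolding W_def by blast

lemma W_diagonal_memI: "x \<in> cantor \<Longrightarrow> (x, x) \<in> W X"
  unfolding W_def \<Delta>_def by blast

lemma clopen_in_Compl: "clopen_in S A \<Longrightarrow> clopen_in S (S - A)"
  unfolding clopen_in_def by (metis closedin_diff closedin_topspace openin_diff openin_topspace topspace_euclidean_subtopology)

lemma clopen_in_preimage:
  assumes "clopen_in T A" "continuous_on S f" "f ` S \<subseteq> T"
  shows "clopen_in S (S \<inter> f -` A)"
  using assms continuous_openin_preimage[of S f T A] continuous_closedin_preimage_gen[of S f T A]
  unfolding clopen_in_def by blast

text \<open>
  The set \<open>X \<union> cantor \<times> {0}\<close> is mapped into \<open>W X\<close> by \<open>\<phi> j\<close>, so connectibility applies
  to the preimage of \<open>A\<close>.
\<close>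
lemma connectible_arc_start:
  assumes "connectible X" "clopen_in (W X) A" "(c, t) \<in> X" "\<phi> j (c, t) \<in> A"
  shows "(lo j c, lo j c) \<in> A"
proof -
  let ?Y = "X \<union> cantor \<times> {0}"
  have X: "X \<subseteq> cantor \<times> {0<..<1}" using assms(1) by (simp add: connectible_def)
  have "\<phi> j ` ?Y \<subseteq> W X"
    by (auto simp: \<phi>_endpoints intro!: W_arc_memI W_diagonal_memI lo_in_cantor)
  then have "clopen_in ?Y (?Y \<inter> \<phi> j -` A)"
    by (rule clopen_in_preimage[OF assms(2) continuous_\<phi>])
  moreover have "c \<in> cantor" using X assms(3) by auto
  moreover have "(?Y \<inter> \<phi> j -` A) \<inter> ({c} \<times> {0<..<1}) \<noteq> {}"
  proof -
    have "(c, t) \<in> (?Y \<inter> \<phi> j -` A) \<inter> ({c} \<times> {0<..<1})" using X assms(3,4) by auto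
    then show ?thesis by blast
  qed
  ultimately have "(c, 0) \<in> ?Y \<inter> \<phi> j -` A"
    using assms(1) unfolding connectible_def by metis
  then show ?thesis by (simp add: \<phi>_endpoints)
qed

lemma connectible_arc_iff:
  assumes "connectible X" "clopen_in (W X) A" "(c, t) \<in> X"
  shows "\<phi> j (c, t) \<in> A \<longleftrightarrow> (lo j c, lo j c) \<in> A"
  using connectible_arc_start[OF assms, of j]
    connectible_arc_start[OF assms(1) clopen_in_Compl[OF assms(2)] assms(3), of j]
    W_arc_memI[OF assms(3), of j] by blast

text \<open>
  Connectibility controls the starts of the arcs, density the ends. The arcs with index near
  \<open>c\<close> start in \<open>A\<close>, so the points of \<open>X\<close> on them are mapped into \<open>A\<close>. By density
  such points approach \<open>(c, 1)\<close>.
\<close>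
lemma connectible_arc_end:
  assumes "connectible X" "cantor \<times> {0<..<1} \<subseteq> closure X" "clopen_in (W X) A" "c \<in> cantor"
    and start: "(lo j c, lo j c) \<in> A"
  shows "(hi j c, hi j c) \<in> A"
proof -
  have X: "X \<subseteq> cantor \<times> {0<..<1}" using assms(1) by (simp add: connectible_def)
  obtain U where U: "open U" "A = W X \<inter> U"
    using assms(3) by (auto simp: clopen_in_def openin_open)
  obtain V where V: "closed V" "A = W X \<inter> V"
    using assms(3) by (auto simp: clopen_in_def closedin_closed)
  have "continuous_on UNIV (\<lambda>p. \<phi> j (fst p, 0))"
    by (intro continuous_on_compose2[OF continuous_\<phi>[of UNIV]] continuous_intros subset_UNIV)
  then have "open ((\<lambda>p. \<phi> j (fst p, 0)) -` U)" by (rule open_vimage[OF U(1)])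
  moreover have "(c, 1) \<in> (\<lambda>p. \<phi> j (fst p, 0)) -` U" using start U(2) by (simp add: \<phi>_endpoints)
  moreover have "(c, 1) \<in> closure X" using closure_dense_part[OF assms(2)] assms(4) by auto
  ultimately have "(c, 1) \<in> closure (X \<inter> (\<lambda>p. \<phi> j (fst p, 0)) -` U)"
    using open_Int_closure_subset[of "(\<lambda>p. \<phi> j (fst p, 0)) -` U" X] unfolding Int_commute[of _ X]
    by blast
  moreover have "X \<inter> (\<lambda>p. \<phi> j (fst p, 0)) -` U \<subseteq> \<phi> j -` V"
  proof
    fix p assume p: "p \<in> X \<inter> (\<lambda>p. \<phi> j (fst p, 0)) -` U"
    obtain c' t where ct: "p = (c', t)" by (cases p)
    with p X have "(lo j c', lo j c') \<in> A"
      unfolding U(2) by (auto simp: \<phi>_endpoints intro!: W_diagonal_memI lo_in_cantor)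
    then have "\<phi> j p \<in> A"
      using connectible_arc_iff[OF assms(1,3)] p unfolding ct by blast
    then show "p \<in> \<phi> j -` V" using V(2) by simp
  qed
  moreover have "closed (\<phi> j -` V)" by (rule closed_vimage[OF V(1) continuous_\<phi>])
  ultimately have "(c, 1) \<in> \<phi> j -` V" by (meson closure_minimal subsetD)
  then show ?thesis unfolding V(2) by (simp add: \<phi>_endpoints W_diagonal_memI hi_in_cantor assms(4))
qed

lemma connected_W:
  assumes "connectible X" "cantor \<times> {0<..<1} \<subseteq> closure X"
  shows "connected (W X)"
  unfolding connected_clopen
proof (intro allI impI)
  fix A assume "openin (top_of_set (W X)) A \<and> closedin (top_of_set (W X)) A"
  then have A: "clopen_in (W X) A" by (simp add: clopen_in_def)
  then have "A \<subseteq> W X" by (auto simp: clopen_in_def dest: openin_imp_subset)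
  have X: "X \<subseteq> cantor \<times> {0<..<1}" using assms(1) by (simp add: connectible_def)
  define D where "D = cantor \<inter> (\<lambda>x. (x, x)) -` A"
  have "clopen_in cantor D"
    unfolding D_def
    by (rule clopen_in_preimage[OF A]) (auto intro!: continuous_intros W_diagonal_memI)
  moreover have "lo j c \<in> D \<longleftrightarrow> hi j c \<in> D" if c: "c \<in> cantor" for j c
    using connectible_arc_end[OF assms A c, of j]
      connectible_arc_end[OF assms clopen_in_Compl[OF A] c, of j]
      lo_in_cantor[OF c, of j] hi_in_cantor[OF c, of j] W_diagonal_memI
    unfolding D_def by blast
  ultimately have D: "D = {} \<or> D = cantor" using invariant_clopen_trivial by blast
  have arc: "\<phi> j p \<in> A \<longleftrightarrow> lo j (fst p) \<in> D" if "p \<in> X" for j p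
    using connectible_arc_iff[OF assms(1) A, of "fst p" "snd p" j] that X lo_in_cantor[of "fst p" j]
    by (auto simp: D_def)
  from D show "A = {} \<or> A = W X"
  proof
    assume "D = {}"
    have "q \<notin> A" if "q \<in> W X" for q
    proof -
      from that consider x where "x \<in> cantor" "q = (x, x)" | j p where "p \<in> X" "q = \<phi> j p"
        unfolding W_def \<Delta>_def by blast
      then show ?thesis
        by cases (use \<open>D = {}\<close> arc in \<open>auto simp: D_def\<close>)
    qed
    then show ?thesis using \<open>A \<subseteq> W X\<close> by blast
  next
    assume "D = cantor"
    have "q \<in> A" if "q \<in> W X" for q
    proof -
      from that consider x where "x \<in> cantor" "q = (x, x)" | j p where "p \<in> X" "q = \<phi> j p"
        unfolding W_def \<Delta>_def by blast
      then show ?thesis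
      proof cases
        case (1 x)
        then have "x \<in> D" using \<open>D = cantor\<close> by simp
        then show ?thesis using 1(2) by (simp add: D_def)
      next
        case (2 j p)
        then have "lo j (fst p) \<in> cantor" using X by (intro lo_in_cantor) auto
        then show ?thesis using arc[OF 2(1)] \<open>D = cantor\<close> 2(2) by simp
      qed
    qed
    with \<open>A \<subseteq> W X\<close> show ?thesis by blast
  qed
qed

section \<open>Wide connectedness\<close>

lemma continuum_cases:
  assumes "z \<in> W (cantor \<times> {0<..<1})"
  obtains j c t where "c \<in> cantor" "t \<in> {0<..<1}" "z = \<phi> j (c, t)"
  | x where "x \<in> cantor" "z = (x, x)"
  using assms unfolding W_def \<Delta>_def by blast

text \<open>
  Cut all arcs at height \<open>r\<close> and keep the halves that are attached to a point of \<open>D\<close>. An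
  arc with both endpoints in \<open>D\<close> is kept whole, so the cut takes effect only on the arcs that
  join \<open>D\<close> to its complement.
\<close>
definition half_arcs :: "real \<Rightarrow> real set \<Rightarrow> (real \<times> real) set" where
  "half_arcs r D = (\<Union>j. \<phi> j ` ({c \<in> cantor. lo j c \<in> D} \<times> {0..r} \<union> {c \<in> cantor. hi j c \<in> D} \<times> {r..1}))"

lemma arc_in_half_arcs_iff:
  assumes "c \<in> cantor" "t \<in> {0<..<1}" "r \<in> {0<..<1}"
  shows "\<phi> j (c, t) \<in> half_arcs r D \<longleftrightarrow> lo j c \<in> D \<and> t \<le> r \<or> hi j c \<in> D \<and> r \<le> t"
proof
  assume "\<phi> j (c, t) \<in> half_arcs r D"
  then obtain j' c' t' where *: "\<phi> j (c, t) = \<phi> j' (c', t')" "c' \<in> cantor"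
    "lo j' c' \<in> D \<and> t' \<in> {0..r} \<or> hi j' c' \<in> D \<and> t' \<in> {r..1}"
    unfolding half_arcs_def by blast
  then have "j = j' \<and> c = c' \<and> t = t'"
    using assms by (intro \<phi>_inject) auto
  then show "lo j c \<in> D \<and> t \<le> r \<or> hi j c \<in> D \<and> r \<le> t" using *(3) by auto
next
  assume "lo j c \<in> D \<and> t \<le> r \<or> hi j c \<in> D \<and> r \<le> t"
  then have "(c, t) \<in> {c \<in> cantor. lo j c \<in> D} \<times> {0..r} \<union> {c \<in> cantor. hi j c \<in> D} \<times> {r..1}"
    using assms by auto
  then show "\<phi> j (c, t) \<in> half_arcs r D" unfolding half_arcs_def by blast
qed

lemma diagonal_in_half_arcs_iff:
  assumes "x \<in> cantor" "r \<in> {0<..<1}"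
  shows "(x, x) \<in> half_arcs r D \<longleftrightarrow> x \<in> D"
proof
  assume "(x, x) \<in> half_arcs r D"
  then obtain j c t where *: "(x, x) = \<phi> j (c, t)" "c \<in> cantor"
    "lo j c \<in> D \<and> t \<in> {0..r} \<or> hi j c \<in> D \<and> t \<in> {r..1}"
    unfolding half_arcs_def by blast
  have "fst (\<phi> j (c, t)) = snd (\<phi> j (c, t))" unfolding *(1)[symmetric] by simp
  moreover have "t \<in> {0..1}" using *(3) assms(2) by auto
  ultimately consider "t = 0" | "t = 1" using \<phi>_side(3)[OF *(2)] by blast
  then show "x \<in> D"
  proof cases
    case 1
    then show ?thesis using * assms(2) by (simp add: \<phi>_endpoints)
  next
    case 2
    then show ?thesis using * assms(2) by (simp add: \<phi>_endpoints)
  qed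
next
  assume "x \<in> D"
  obtain c where c: "c \<in> cantor" "x = lo 0 c \<or> x = hi 0 c"
    using cantor_endpoint_above[OF assms(1)] by blast
  have "(x, x) = \<phi> 0 (c, 0) \<and> lo 0 c \<in> D \<or> (x, x) = \<phi> 0 (c, 1) \<and> hi 0 c \<in> D"
    using c(2) \<open>x \<in> D\<close> by (auto simp: \<phi>_endpoints)
  moreover have "0 \<in> {0..r}" "1 \<in> {r..1}" using assms(2) by auto
  ultimately show "(x, x) \<in> half_arcs r D" unfolding half_arcs_def using c(1) by blast
qed

text \<open>
  A cylinder set containing the origin contributes the origin, and one that does not contain it
  stays away from it and thus meets the ends of finitely many families only.
\<close>
lemma closed_half_arcs:
  assumes "r \<in> {0<..<1}" and D: "D = {y \<in> cantor. addr m y \<in> B}"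
  shows "closed (half_arcs r D)"
  unfolding half_arcs_def
proof (rule closed_union_of_arcs)
  have "closed D" unfolding D by (rule closed_cylinders)
  have part: "compact {c \<in> cantor. f c \<in> D}" if "continuous_on cantor f" for f
  proof -
    have "{c \<in> cantor. f c \<in> D} = cantor \<inter> f -` D" by blast
    moreover have "closed (cantor \<inter> f -` D)"
      by (rule continuous_closed_preimage[OF that compact_imp_closed[OF compact_cantor] \<open>closed D\<close>])
    then have "compact (cantor \<inter> (cantor \<inter> f -` D))" by (rule compact_Int_closed[OF compact_cantor])
    ultimately show ?thesis by simp
  qed
  show "compact ({c \<in> cantor. lo j c \<in> D} \<times> {0..r} \<union> {c \<in> cantor. hi j c \<in> D} \<times> {r..1})" for j
    by (intro compact_Un compact_Times part continuous_lo_hi compact_Icc)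
  show "{c \<in> cantor. lo j c \<in> D} \<times> {0..r} \<union> {c \<in> cantor. hi j c \<in> D} \<times> {r..1} \<subseteq> cantor \<times> {0..1}" for j
    using assms(1) by auto
  let ?R = "\<lambda>j. {c \<in> cantor. lo j c \<in> D} \<times> {0..r} \<union> {c \<in> cantor. hi j c \<in> D} \<times> {r..1}"
  show "(0, 0) \<in> (\<Union>j. \<phi> j ` ?R j) \<or> (\<exists>N. \<forall>j\<ge>N. ?R j = {})"
  proof (cases "0 \<in> D")
    case True
    then have "(0, 0) \<in> half_arcs r D"
      using diagonal_in_half_arcs_iff[OF zero_in_cantor assms(1)] by blast
    then show ?thesis unfolding half_arcs_def by blast
  next
    case False
    have "?R j = {}" if j: "j \<ge> m + 2" for j
    proof -
      have "(3::real) / 3 ^ j \<le> 3 / 3 ^ (m + 2)"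
        using j by (intro divide_left_mono power_increasing) auto
      also have "\<dots> < (1/3) ^ m" by (simp add: field_simps power_divide)
      finally have small: "(3::real) / 3 ^ j < (1/3) ^ m" .
      have far: "y \<notin> D" if "y \<in> cantor" "y \<le> 3 / 3 ^ j" for y
      proof -
        have "\<bar>y - 0\<bar> < (1/3) ^ m" using that small cantor_bounds[of y] by auto
        then have "addr m y = addr m 0" by (rule close_imp_addr_eq[OF that(1) zero_in_cantor])
        then show ?thesis using False zero_in_cantor by (simp add: D)
      qed
      have "lo j c \<notin> D \<and> hi j c \<notin> D" if c: "c \<in> cantor" for c
        using far[OF lo_in_cantor[OF c], of j] far[OF hi_in_cantor[OF c], of j]
          lo_less_hi[OF c, of j] lo_hi_range(2)[OF c, of j] j by auto
      then show ?thesis by auto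
    qed
    then show ?thesis by blast
  qed
qed

text \<open>
  An arc on the same side of the diagonal as \<open>\<phi> i (c0, _)\<close> that starts close to one of its
  endpoints belongs to the same family and has a nearby index: different families below the
  diagonal end in separated intervals, and \<open>lo_hi_gap\<close> excludes the far end.
\<close>
lemma near_endpoint_same_arc:
  assumes c: "c \<in> cantor" "c0 \<in> cantor" and ij: "j = 0 \<longleftrightarrow> i = 0"
    and small: "e < 1 / 3 ^ (i + 1)"
    and near: "\<bar>lo j c - lo i c0\<bar> \<le> e \<or> \<bar>lo j c - hi i c0\<bar> \<le> e"
  shows "j = i \<and> \<bar>c - c0\<bar> / 3 ^ (i + 1) \<le> e"
proof -
  have "j = i"
  proof (rule ccontr)
    assume "j \<noteq> i"
    with ij have pos: "i > 0" "j > 0" by auto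
    define w :: "nat \<Rightarrow> real" where "w n = 1 / 3 ^ n" for n
    have range: "2 * w i \<le> lo i c0" "lo i c0 < hi i c0" "hi i c0 \<le> 3 * w i"
      "2 * w j \<le> lo j c" "lo j c < hi j c" "hi j c \<le> 3 * w j"
      using lo_hi_range[OF c(2) pos(1)] lo_hi_range[OF c(1) pos(2)] lo_less_hi c
      by (simp_all add: w_def)
    have sep: "3 * w n \<le> w m" if "m < n" for m n :: nat
    proof -
      have "(3::real) ^ Suc m \<le> 3 ^ n" using that by (intro power_increasing) auto
      then have "(3::real) / 3 ^ n \<le> 3 / 3 ^ Suc m" by (intro divide_left_mono) auto
      then show ?thesis by (simp add: w_def)
    qed
    have e: "3 * e < w i" "0 < w i" using small by (simp_all add: w_def field_simps)
    consider "i < j" | "j < i" using \<open>j \<noteq> i\<close> by linarith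
    then show False
    proof cases
      case 1
      from sep[OF this] range e near show False by linarith
    next
      case 2
      from sep[OF this] range e near show False by linarith
    qed
  qed
  moreover have "\<not> \<bar>lo i c - hi i c0\<bar> \<le> e"
    using lo_hi_gap[OF c, of i] small by linarith
  ultimately show ?thesis using near lo_diff[of i c c0] by auto
qed

text \<open>
  The central separation argument: \<open>S\<close> avoids the arcs parallel to \<open>\<phi> i (c0, _)\<close> at height
  \<open>r\<close>, so these are cut for \<open>S\<close>. The connected set \<open>S\<close> remains in the component of the cut
  continuum that contains \<open>\<phi> j (c, t)\<close>, and this component passes through a finite block of
  diagonal points.
\<close>
lemma nondense_meets_finitely_many_arcs:
  assumes S: "S \<subseteq> W (cantor \<times> {0<..<1})" "connected S"
    and miss: "c0 \<in> cantor" "r \<in> {0<..<1}" "\<phi> i (c0, r) \<notin> closure S"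
    and z: "c \<in> cantor" "t \<in> {0<..<1}" "\<phi> j (c, t) \<in> S"
  shows "finite {c \<in> cantor. \<exists>t\<in>{0<..<1}. \<phi> k (c, t) \<in> S}"
proof -
  have "open ((\<lambda>c. \<phi> i (c, r)) -` (- closure S))"
    by (intro open_vimage continuous_on_compose2[OF continuous_\<phi>[of UNIV]] continuous_intros) auto
  then obtain d where d: "d > 0" "\<And>c. \<bar>c - c0\<bar> < d \<Longrightarrow> \<phi> i (c, r) \<notin> S"
    using miss(3) closure_subset[of S] unfolding open_dist
    by (force simp: dist_real_def)
  obtain n where n: "(1/3::real) ^ n < min (d / 3 ^ (i + 1)) (1 / 3 ^ (i + 1))"
    using real_arch_pow_inv[of "min (d / 3 ^ (i + 1)) (1 / 3 ^ (i + 1))" "1/3"] d(1) by auto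
  define Z where "Z = {y. addr n y = addr n (lo i c0) \<or> addr n y = addr n (hi i c0)}"
  have cut: "\<phi> l (b, r) \<notin> S" if "b \<in> cantor" "(l = 0 \<longleftrightarrow> i = 0) \<and> lo l b \<in> Z" for l b
  proof -
    have "\<bar>lo l b - lo i c0\<bar> \<le> (1/3) ^ n \<or> \<bar>lo l b - hi i c0\<bar> \<le> (1/3) ^ n"
      using that miss(1) addr_eq_imp_close lo_in_cantor hi_in_cantor unfolding Z_def by blast
    then have "l = i \<and> \<bar>b - c0\<bar> / 3 ^ (i + 1) \<le> (1/3) ^ n"
      using that n by (intro near_endpoint_same_arc miss(1)) auto
    moreover from this n have "\<bar>b - c0\<bar> / 3 ^ (i + 1) < d / 3 ^ (i + 1)" by linarith
    then have "\<bar>b - c0\<bar> < d" by (simp add: divide_less_cancel)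
    ultimately show ?thesis using d(2) by blast
  qed
  \<comment> \<open>The endpoint to which the given point of \<open>S\<close> stays attached if its own arc is cut.\<close>
  define x where "x = (if t \<le> r then lo j c else hi j c)"
  have "x \<in> cantor" using z(1) by (simp add: x_def lo_in_cantor hi_in_cantor)
  obtain F where F: "finite F" "F \<subseteq> cantor" "x \<in> F"
    "\<And>m l b. n \<le> m \<Longrightarrow> b \<in> cantor \<Longrightarrow> \<not> ((l = 0 \<longleftrightarrow> i = 0) \<and> lo l b \<in> Z) \<Longrightarrow>
       addr m (lo l b) \<in> addr m ` F \<longleftrightarrow> addr m (hi l b) \<in> addr m ` F"
    using finite_block_of_endpoints[OF miss(1) \<open>x \<in> cantor\<close> Z_def] by metis
  \<comment> \<open>The halves attached to the thickened block and those attached to its complement cover the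
    continuum. They overlap only at height \<open>r\<close> on the cut arcs, where \<open>S\<close> has no points.\<close>
  have inside: "S \<subseteq> half_arcs r {y \<in> cantor. addr m y \<in> addr m ` F}" if m: "n \<le> m" for m
  proof -
    define D D' where "D = {y \<in> cantor. addr m y \<in> addr m ` F}"
      and "D' = {y \<in> cantor. addr m y \<in> - addr m ` F}"
    have DD': "y \<in> D' \<longleftrightarrow> y \<notin> D" if "y \<in> cantor" for y using that by (auto simp: D_def D'_def)
    have closed: "closed (half_arcs r D)" "closed (half_arcs r D')"
      using closed_half_arcs[OF miss(2)] D_def D'_def by blast+
    have cover: "q \<in> half_arcs r D \<union> half_arcs r D'" if "q \<in> S" for q
    proof -
      have "q \<in> W (cantor \<times> {0<..<1})" using S(1) that by blast
      then show ?thesis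
      proof (cases rule: continuum_cases)
        case (1 l b u)
        show ?thesis
          unfolding 1(3) Un_iff arc_in_half_arcs_iff[OF 1(1,2) miss(2)]
          using DD'[OF lo_in_cantor, of b l] DD'[OF hi_in_cantor, of b l] 1(1) by auto
      next
        case (2 y)
        show ?thesis
          unfolding 2(2) Un_iff diagonal_in_half_arcs_iff[OF 2(1) miss(2)] using DD' 2(1) by blast
      qed
    qed
    have disjoint: "q \<notin> half_arcs r D'" if q: "q \<in> S" "q \<in> half_arcs r D" for q
    proof -
      have "q \<in> W (cantor \<times> {0<..<1})" using S(1) q by blast
      then show ?thesis
      proof (cases rule: continuum_cases)
        case (1 l b u)
        have "lo l b \<in> D \<longleftrightarrow> hi l b \<in> D" if "u = r"
        proof -
          have "\<not> ((l = 0 \<longleftrightarrow> i = 0) \<and> lo l b \<in> Z)" using cut[OF 1(1), of l] q(1) unfolding 1(3) that by blast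
          then show ?thesis
            using F(4)[OF m 1(1)] 1(1) by (simp add: D_def lo_in_cantor hi_in_cantor)
        qed
        with q(2) show ?thesis
          unfolding 1(3) arc_in_half_arcs_iff[OF 1(1,2) miss(2)]
          using DD'[OF lo_in_cantor, of b l] DD'[OF hi_in_cantor, of b l] 1(1) by auto
      next
        case (2 y)
        with q(2) show ?thesis
          unfolding 2(2) diagonal_in_half_arcs_iff[OF 2(1) miss(2)] using DD' 2(1) by blast
      qed
    qed
    have "x \<in> D" using F(3) \<open>x \<in> cantor\<close> by (simp add: D_def)
    then have "\<phi> j (c, t) \<in> half_arcs r D"
      unfolding arc_in_half_arcs_iff[OF z(1,2) miss(2)] by (auto simp: x_def split: if_splits)
    then have "half_arcs r D' \<inter> S = {}"
      using S(2) closed cover disjoint z(3) unfolding connected_closed by blast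
    then show ?thesis using cover unfolding D_def by blast
  qed
  \<comment> \<open>As \<open>F\<close> is finite, a point outside of it is left out by all sufficiently thin thickenings.\<close>
  have "lo k b \<in> F \<or> hi k b \<in> F"
    if b: "b \<in> cantor" "u \<in> {0<..<1}" "\<phi> k (b, u) \<in> S" for b u
  proof (rule ccontr)
    assume out: "\<not> (lo k b \<in> F \<or> hi k b \<in> F)"
    obtain e1 where e1: "e1 > 0" "\<And>y. y \<in> F \<Longrightarrow> y \<noteq> lo k b \<Longrightarrow> e1 \<le> dist (lo k b) y"
      using finite_set_avoid[OF F(1), of "lo k b"] by blast
    obtain e2 where e2: "e2 > 0" "\<And>y. y \<in> F \<Longrightarrow> y \<noteq> hi k b \<Longrightarrow> e2 \<le> dist (hi k b) y"
      using finite_set_avoid[OF F(1), of "hi k b"] by blast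
    obtain m0 where m0: "(1/3::real) ^ m0 < min e1 e2"
      using real_arch_pow_inv[of "min e1 e2" "1/3"] e1(1) e2(1) by auto
    define m where "m = max n m0"
    have "(1/3::real) ^ m \<le> (1/3) ^ m0" by (intro power_decreasing) (auto simp: m_def)
    with m0 have m: "(1/3) ^ m < e1" "(1/3) ^ m < e2" by linarith+
    have "addr m (lo k b) \<noteq> addr m y \<and> addr m (hi k b) \<noteq> addr m y" if "y \<in> F" for y
      using addr_eq_imp_close[OF lo_in_cantor[OF b(1)], of y m k]
        addr_eq_imp_close[OF hi_in_cantor[OF b(1)], of y m k]
        e1(2)[OF that] e2(2)[OF that] m that F(2) out by (fastforce simp: dist_real_def)
    moreover have "\<phi> k (b, u) \<in> half_arcs r {y \<in> cantor. addr m y \<in> addr m ` F}"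
      using inside[of m] b(3) by (auto simp: m_def)
    ultimately show False
      unfolding arc_in_half_arcs_iff[OF b(1,2) miss(2)] by auto
  qed
  then have "{c \<in> cantor. \<exists>t\<in>{0<..<1}. \<phi> k (c, t) \<in> S} \<subseteq> lo k -` F \<union> hi k -` F" by blast
  moreover have "finite (lo k -` F \<union> hi k -` F)"
    using F(1) inj_lo inj_hi by (simp add: finite_vimageI)
  ultimately show ?thesis by (rule finite_subset)
qed

text \<open>
  If \<open>S\<close> meets finitely many arcs of the family \<open>j\<close>, then the arc of \<open>c\<close> is isolated in
  \<open>S\<close> from its parallels, and a piece of it between two points outside of \<open>S\<close> is clopen in
  \<open>S\<close>.
\<close>
lemma confined_to_subarc:
  assumes S: "S \<subseteq> W (cantor \<times> {0<..<1})" "connected S"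
    and fin: "finite {c \<in> cantor. \<exists>t\<in>{0<..<1}. \<phi> j (c, t) \<in> S}"
    and c: "c \<in> cantor" and t: "0 < s" "s < t" "t < u" "u < 1"
    and z: "\<phi> j (c, t) \<in> S" "\<phi> j (c, s) \<notin> S" "\<phi> j (c, u) \<notin> S"
  shows "S \<subseteq> \<phi> j ` ({c} \<times> {s..u})"
proof -
  define T where "T = {c \<in> cantor. \<exists>t\<in>{0<..<1}. \<phi> j (c, t) \<in> S}"
  \<comment> \<open>The rest of the continuum, as far as \<open>S\<close> reaches: of the family \<open>j\<close> only finitely many
    arcs are kept, which makes the union closed. All diagonal points are kept.\<close>
  define R where "R k = (if k = j
    then cantor \<times> {0} \<union> cantor \<times> {1} \<union> {c} \<times> {0..s} \<union> {c} \<times> {u..1} \<union> (T - {c}) \<times> {0..1}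
    else cantor \<times> {0..1})" for k
  define A B where "A = \<phi> j ` ({c} \<times> {s..u})" and "B = (\<Union>k. \<phi> k ` R k)"
  have "finite (T - {c})" using fin by (simp add: T_def)
  then have "compact (T - {c})" by (rule finite_imp_compact)
  then have "compact (R k)" for k
    using compact_cantor unfolding R_def by (auto intro!: compact_Un compact_Times)
  moreover have "R k \<subseteq> cantor \<times> {0..1}" for k
    using c t by (auto simp: R_def T_def)
  moreover have diagonal: "(x, x) \<in> B" if x: "x \<in> cantor" for x
  proof -
    obtain b where b: "b \<in> cantor" "x = lo 0 b \<or> x = hi 0 b"
      using cantor_endpoint_above[OF x] by blast
    then have "(x, x) = \<phi> 0 (b, 0) \<or> (x, x) = \<phi> 0 (b, 1)" by (auto simp: \<phi>_endpoints)
    moreover have "(b, 0) \<in> R 0" "(b, 1) \<in> R 0" using b(1) by (auto simp: R_def)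
    ultimately show ?thesis unfolding B_def by blast
  qed
  ultimately have "closed B"
    unfolding B_def using zero_in_cantor by (intro closed_union_of_arcs) auto
  moreover have "closed A"
    unfolding A_def
    by (intro compact_imp_closed compact_continuous_image continuous_\<phi> compact_Times) auto
  moreover have "q \<in> A \<union> B" if "q \<in> S" for q
  proof -
    have "q \<in> W (cantor \<times> {0<..<1})" using S(1) that by blast
    then show ?thesis
    proof (cases rule: continuum_cases)
      case (1 l b v)
      then have "(b, v) \<in> R l \<or> l = j \<and> (b, v) \<in> {c} \<times> {s..u}"
        using that by (auto simp: R_def T_def)
      then show ?thesis using 1(3) unfolding A_def B_def by blast
    qed (use diagonal in blast)
  qed
  moreover have "A \<inter> B \<inter> S = {}"
  proof -
    have False if q: "q \<in> A" "q \<in> B" "q \<in> S" for q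
    proof -
      obtain v where v: "v \<in> {s..u}" "q = \<phi> j (c, v)" using q(1) by (auto simp: A_def)
      obtain k b w where b: "(b, w) \<in> R k" "q = \<phi> k (b, w)" using q(2) by (auto simp: B_def)
      have "b \<in> cantor" "w \<in> {0..1}" using b(1) c t by (auto simp: R_def T_def split: if_splits)
      moreover have "\<phi> j (c, v) = \<phi> k (b, w)" using v b by simp
      ultimately have "j = k \<and> c = b \<and> v = w"
        using c v t by (intro \<phi>_inject) auto
      then have "v = s \<or> v = u" using b(1) v t by (auto simp: R_def)
      then show False using v q(3) z by auto
    qed
    then show ?thesis by blast
  qed
  moreover have "\<phi> j (c, t) \<in> A" unfolding A_def using t by (intro imageI) auto
  then have "A \<inter> S \<noteq> {}" using z(1) by blast
  ultimately have "B \<inter> S = {}" using S(2) unfolding connected_closed by blast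
  then show ?thesis using \<open>\<And>q. q \<in> S \<Longrightarrow> q \<in> A \<union> B\<close> unfolding A_def by blast
qed

lemma connected_in_cantor_trivial:
  assumes "connected S" "S \<subseteq> cantor" "x \<in> S" "y \<in> S"
  shows "x = y"
proof (rule ccontr)
  assume "x \<noteq> y"
  then obtain n where n: "(1/3::real) ^ n < \<bar>x - y\<bar>"
    using real_arch_pow_inv[of "\<bar>x - y\<bar>" "1/3"] by auto
  have "addr n x \<noteq> addr n y"
  proof
    assume "addr n x = addr n y"
    then show False using addr_eq_imp_close[of x y n] assms n by auto
  qed
  define A B where "A = {z \<in> cantor. addr n z \<in> {addr n x}}"
    and "B = {z \<in> cantor. addr n z \<in> - {addr n x}}"
  have "closed A" "closed B" unfolding A_def B_def by (rule closed_cylinders)+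
  moreover have "S \<subseteq> A \<union> B" "A \<inter> B \<inter> S = {}" using assms(2) by (auto simp: A_def B_def)
  moreover have "x \<in> A \<inter> S" "y \<in> B \<inter> S"
    using assms \<open>addr n x \<noteq> addr n y\<close> by (auto simp: A_def B_def)
  ultimately show False using assms(1) unfolding connected_closed by blast
qed

lemma hereditarily_disconnected_fibre:
  assumes "hereditarily_disconnected X" "a < (b::real)"
  obtains s where "a < s" "s < b" "(c, s) \<notin> X"
proof -
  have "connected ({c} \<times> {a<..<b})" by (intro connected_Times) auto
  moreover have "\<exists>x\<in>{c} \<times> {a<..<b}. \<exists>y\<in>{c} \<times> {a<..<b}. x \<noteq> y"
  proof -
    obtain s where "a < s" "s < b" using dense[OF assms(2)] by blast
    moreover obtain s' where "s < s'" "s' < b" using dense[OF \<open>s < b\<close>] by blast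
    ultimately have "(c, s) \<in> {c} \<times> {a<..<b}" "(c, s') \<in> {c} \<times> {a<..<b}" "(c, s) \<noteq> (c, s')" by auto
    then show ?thesis by blast
  qed
  ultimately have "\<not> {c} \<times> {a<..<b} \<subseteq> X"
    using assms(1) unfolding hereditarily_disconnected_def by metis
  then obtain q where q: "q \<in> {c} \<times> {a<..<b}" "q \<notin> X" by blast
  then have "q = (c, snd q)" by auto
  then show ?thesis using q by (intro that[of "snd q"]) auto
qed

text \<open>
  On an arc met by \<open>S\<close>, holes of the fibre of \<open>X\<close> just below and just above the height of a
  point of \<open>S\<close> confine \<open>S\<close> to an arbitrarily short piece of that arc.
\<close>
lemma nondense_trivial:
  assumes X: "X \<subseteq> cantor \<times> {0<..<1}" "hereditarily_disconnected X"
    and S: "S \<subseteq> W X" "connected S"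
    and miss: "(c0, r) \<in> X" "\<phi> i (c0, r) \<notin> closure S"
    and pq: "p \<in> S" "q \<in> S"
  shows "p = q"
proof (rule ccontr)
  assume "p \<noteq> q"
  have SK: "S \<subseteq> W (cantor \<times> {0<..<1})" using S(1) X(1) unfolding W_def by blast
  have on_arc: "(c, t) \<in> X" if "\<phi> j (c, t) \<in> S" "c \<in> cantor" "t \<in> {0<..<1}" for j c t
  proof -
    have "\<phi> j (c, t) \<in> W X" using S(1) that(1) by blast
    then consider k b u where "(b, u) \<in> X" "\<phi> j (c, t) = \<phi> k (b, u)"
      | y where "\<phi> j (c, t) = (y, y)" unfolding W_def \<Delta>_def by fastforce
    then show ?thesis
    proof cases
      case (1 k b u)
      then have "j = k \<and> c = b \<and> t = u" using that X(1) by (intro \<phi>_inject) auto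
      then show ?thesis using 1(1) by simp
    next
      case (2 y)
      then show ?thesis using \<phi>_side(3)[of c t j] that by auto
    qed
  qed
  have "\<not> S \<subseteq> \<Delta>"
  proof
    assume "S \<subseteq> \<Delta>"
    then have diag: "fst ` S \<subseteq> cantor" "\<forall>z\<in>S. z = (fst z, fst z)" unfolding \<Delta>_def by auto
    have "connected (fst ` S)" by (intro connected_continuous_image continuous_intros S(2))
    then have "fst p = fst q" using connected_in_cantor_trivial diag(1) pq by blast
    then show False using diag(2) pq \<open>p \<noteq> q\<close> by metis
  qed
  then obtain j c t where z: "\<phi> j (c, t) \<in> S" "(c, t) \<in> X"
    using S(1) unfolding W_def by force
  then have c: "c \<in> cantor" and t: "t \<in> {0<..<1}" using X(1) by auto
  have "c0 \<in> cantor" "r \<in> {0<..<1}" using miss(1) X(1) by auto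
  then have fin: "finite {c \<in> cantor. \<exists>t\<in>{0<..<1}. \<phi> j (c, t) \<in> S}"
    using nondense_meets_finitely_many_arcs[OF SK S(2)] miss(2) c t z(1) by blast
  have confined: "S \<subseteq> \<phi> j ` ({c} \<times> {s..u})"
    if "0 < s" "s < t" "t < u" "u < 1" "(c, s) \<notin> X" "(c, u) \<notin> X" for s u
  proof (rule confined_to_subarc[OF SK S(2) fin c that(1-4) z(1)])
    show "\<phi> j (c, s) \<notin> S" "\<phi> j (c, u) \<notin> S" using on_arc[of j c] c that by auto
  qed
  obtain s0 where s0: "0 < s0" "s0 < t" "(c, s0) \<notin> X"
    using hereditarily_disconnected_fibre[OF X(2), of 0 t c] t by auto
  obtain u0 where u0: "t < u0" "u0 < 1" "(c, u0) \<notin> X"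
    using hereditarily_disconnected_fibre[OF X(2), of t 1 c] t by auto
  have "w = \<phi> j (c, t)" if "w \<in> S" for w
  proof -
    have position: "v \<in> {s..u}"
      if su: "0 < s" "s < t" "t < u" "u < 1" "(c, s) \<notin> X" "(c, u) \<notin> X"
        and v: "v \<in> {0<..<1}" "w = \<phi> j (c, v)" for s u v
    proof -
      obtain v' where "v' \<in> {s..u}" "\<phi> j (c, v) = \<phi> j (c, v')"
        using confined[OF su] \<open>w \<in> S\<close> v(2) by auto
      then show ?thesis using \<phi>_inject[OF c c v(1), of v' j j] su by auto
    qed
    obtain v where v: "w = \<phi> j (c, v)" "v \<in> {s0..u0}"
      using confined[of s0 u0] s0 u0 \<open>w \<in> S\<close> by blast
    then have v01: "v \<in> {0<..<1}" using s0 u0 by auto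
    have "\<not> t < v"
    proof
      assume "t < v"
      then obtain u where "t < u" "u < v" "(c, u) \<notin> X"
        using hereditarily_disconnected_fibre[OF X(2)] by blast
      then show False using position[of s0 u v] s0 v v01 by auto
    qed
    moreover have "\<not> v < t"
    proof
      assume "v < t"
      then obtain s where "v < s" "s < t" "(c, s) \<notin> X"
        using hereditarily_disconnected_fibre[OF X(2)] by blast
      then show False using position[of s u0 v] u0 v v01 by auto
    qed
    ultimately show ?thesis using v(1) by (cases v t rule: linorder_cases) auto
  qed
  then show False using pq \<open>p \<noteq> q\<close> by metis
qed

lemma W_subset_closure_arcs:
  assumes "cantor \<times> {0<..<1} \<subseteq> closure X"
  shows "W X \<subseteq> closure (\<Union>j. \<phi> j ` X)"
proof -
  have arcs: "\<phi> j ` closure X \<subseteq> closure (\<Union>j. \<phi> j ` X)" for j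
  proof (intro image_closure_subset continuous_\<phi> closed_closure)
    show "\<phi> j ` X \<subseteq> closure (\<Union>j. \<phi> j ` X)"
      using closure_subset[of "\<Union>j. \<phi> j ` X"] by blast
  qed
  have "(x, x) \<in> closure (\<Union>j. \<phi> j ` X)" if x: "x \<in> cantor" for x
  proof -
    obtain c where "c \<in> cantor" "(x, x) = \<phi> 0 (c, 0) \<or> (x, x) = \<phi> 0 (c, 1)"
      using cantor_endpoint_above[OF x] by (auto simp: \<phi>_endpoints)
    moreover from this have "(c, 0) \<in> closure X" "(c, 1) \<in> closure X"
      using closure_dense_part[OF assms] by auto
    ultimately show ?thesis using arcs[of 0] by (metis image_subset_iff)
  qed
  then show ?thesis using closure_subset[of "\<Union>j. \<phi> j ` X"] unfolding W_def \<Delta>_def by blast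
qed

theorem proposition1:
  fixes X :: "(real \<times> real) set"
  assumes "X \<subseteq> cantor \<times> {0<..<1}"
    and "cantor \<times> {0<..<1} \<subseteq> closure X"
    and "connectible X"
  shows "connected (W X) \<and> (hereditarily_disconnected X \<longrightarrow> widely_connected (W X))"
proof (intro conjI impI)
  show conn: "connected (W X)" using assms(2,3) by (rule connected_W[rotated])
  assume hd: "hereditarily_disconnected X"
  have "1 \<in> cantor" using cantor_reflect[OF zero_in_cantor] by simp
  then have "(0, 0) \<in> W X" "(1, 1) \<in> W X" using zero_in_cantor by (simp_all add: W_diagonal_memI)
  then have "\<exists>x\<in>W X. \<exists>y\<in>W X. x \<noteq> y" by force
  moreover have "W X \<subseteq> closure S"
    if S: "S \<subseteq> W X" "connected S" "\<exists>x\<in>S. \<exists>y\<in>S. x \<noteq> y" for S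
  proof (rule ccontr)
    assume nondense: "\<not> W X \<subseteq> closure S"
    have "\<not> (\<Union>j. \<phi> j ` X) \<subseteq> closure S"
    proof
      assume "(\<Union>j. \<phi> j ` X) \<subseteq> closure S"
      then have "closure (\<Union>j. \<phi> j ` X) \<subseteq> closure S" by (rule closure_minimal[OF _ closed_closure])
      with W_subset_closure_arcs[OF assms(2)] nondense show False by blast
    qed
    then obtain i p where "p \<in> X" "\<phi> i p \<notin> closure S" by blast
    then have "(fst p, snd p) \<in> X" "\<phi> i (fst p, snd p) \<notin> closure S" by simp_all
    then show False using nondense_trivial[OF assms(1) hd S(1,2)] S(3) by blast
  qed
  ultimately show "widely_connected (W X)" using conn unfolding widely_connected_def by blast
qed

end
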